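(* Consider the quasi-linear system described in the context, with mean function $F(\theta,U)$ and covariance $S(\theta,U)$ of the stacked observations. Let $\theta_i,\theta_j\in\Theta$, let $U=\mathrm{col}(u_0,\dots,u_{N-1})$, and put $\Delta_{i,j}=F(\theta_i,U)-F(\theta_j,U)$, $S_i=S(\theta_i,U)$, $S_j=S(\theta_j,U)$ and $$d_{i,j}(U)=\tfrac18\Delta_{i,j}^{\mathsf T}\left(\tfrac12(S_i+S_j)\right)^{-1}\Delta_{i,j}+\tfrac12\ln\left|\tfrac12(S_i+S_j)\right|-\tfrac14\ln\left(|S_i||S_j|\right).$$ Define $$\tilde A_k=\begin{bmatrix}A(\theta_i,u_k)&0\\ 0&A(\theta_j,u_k)\end{bmatrix},\quad \tilde B_k=\begin{bmatrix}B(\theta_i,u_k)\\ B(\theta_j,u_k)\end{bmatrix},\quad \tilde G_k=\begin{bmatrix}G(\theta_i,u_k)&0\\ 0&G(\theta_j,u_k)\end{bmatrix},\quad \tilde C=\frac1{\sqrt2}\begin{bmatrix}C&-C\end{bmatrix},$$ and let $$\tilde\Sigma_k=S_v+\tilde C\tilde S_k^-\tilde C^{\mathsf T},\qquad \tilde L_k=\tilde S_k^-\tilde C^{\mathsf T}\tilde\Sigma_k^{-1},\qquad \tilde S_k=\tilde S_k^--\tilde L_k\tilde\Sigma_k\tilde L_k^{\mathsf T}\qquad(k=0,\dots,N),$$ $$\tilde m_{k+1}^-=\tilde A_k(\mathbb{I}-\tilde L_k\tilde C)\tilde m_k^-+\tilde B_k,\qquad \tilde S_{k+1}^-=\tilde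 A_k\tilde S_k\tilde A_k^{\mathsf T}+\tilde G_k\tilde G_k^{\mathsf T}\qquad(k=0,\dots,N-1),$$ with initial conditions $$\tilde m_0^-=\begin{bmatrix}m_0^-(\theta_i)\\ m_0^-(\theta_j)\end{bmatrix},\qquad \tilde S_0^-=\begin{bmatrix}S_0^-(\theta_i)&0\\ 0&S_0^-(\theta_j)\end{bmatrix}.$$ Then $$d_{i,j}(U)=\tfrac14\sum_{k=0}^N|\tilde C\tilde m_k^-|^2_{\tilde\Sigma_k^{-1}}+\tfrac12\sum_{k=0}^N\ln|\tilde\Sigma_k|-\tfrac14\ln\left(|S_i||S_j|\right),$$ where $|S_i|$ and $|S_j|$ are calculated by $|S(\theta,U)|=\prod_{k=0}^N|\Sigma_k(\theta)|$ at $\theta=\theta_i$ and $\theta=\theta_j$ respectively, with $\Sigma_k(\theta)$ given by the recursion in the context.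
   Context: Notation: for a vector $x$ and a square matrix $Q$, $|x|_Q^2=x^{\mathsf T}Qx$; $|M|$ is the determinant of a square matrix $M$; $\mathbb{I}$ is an identity matrix ($\mathbb{I}_m$ of size $m$); $\mathrm{col}(\cdot)$ is vertical stacking. Quasi-linear system: $\theta\in\Theta\subset\mathbb{R}^{n_\theta}$, $N\geqslant1$, and $$x_{k+1}=A(\theta,u_k)x_k+B(\theta,u_k)+G(\theta,u_k)w_k\quad(k=0,\dots,N-1),\qquad y_k=Cx_k+v_k\quad(k=0,\dots,N),$$ with $x_k\in\mathbb{R}^n$, $y_k,v_k\in\mathbb{R}^{n_y}$, $w_k\in\mathbb{R}^{n_w}$, $w_k\sim\mathcal{N}(0,\mathbb{I})$, $v_k\sim\mathcal{N}(0,S_v)$, $S_v>0$ (positive definite). Given $\theta$, the variables $x_0,w_0,\dots,w_{N-1},v_0,\dots,v_N$ are mutually independent, and $x_0$ is Gaussian with mean $m_0^-(\theta)$ and covariance $S_0^-(\theta)$, where $m_0^-,S_0^-$ are smooth and $S_0^-(\theta)>0$ for all $\theta\in\Theta$. $A,B,G$ are matrix-valued functions of compatible dimensions ($B$ is $\mathbb{R}^n$-valued). Stacked form: with $A_k=A(\theta,u_k)$, $B_k=B(\theta,u_k)$, $G_k=G(\theta,u_k)$, let $\Phi(n,n)=\mathbb{I}$ and $\Phi(n,j)=A_{n-1}A_{n-2}\cdots A_j$ for $j<n$. Index block rows by $k=0,\dots,N$. $\mathcal{A}(\theta,U)$ has $k$-th block row $\Phi(k,0)$; $\mathcal{B}(\theta,U)$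 has $k$-th block $\sum_{j=0}^{k-1}\Phi(k,j+1)B_j$; $\mathcal{G}(\theta,U)$ has $(k,j)$ block ($0\leqslant j\leqslant N-1$) equal to $\Phi(k,j+1)G_j$ if $j<k$ and $0$ otherwise; $\mathcal{C}=\mathbb{I}_{N+1}\otimes C$. Then $$F(\theta,U)=\mathcal{C}\mathcal{A}(\theta,U)m_0^-(\theta)+\mathcal{C}\mathcal{B}(\theta,U),$$ $$S(\theta,U)=\mathcal{C}\left(\mathcal{A}(\theta,U)S_0^-(\theta)\mathcal{A}(\theta,U)^{\mathsf T}+\mathcal{G}(\theta,U)\mathcal{G}(\theta,U)^{\mathsf T}\right)\mathcal{C}^{\mathsf T}+\mathbb{I}_{N+1}\otimes S_v,$$ so that $Y=\mathrm{col}(y_0,\dots,y_N)$ given $\theta$ is Gaussian with mean $F(\theta,U)$ and covariance $S(\theta,U)$. Recursion for $\Sigma_k(\theta)$: starting from $S_0^-(\theta)$, $\Sigma_k(\theta)=S_v+CS_k^-(\theta)C^{\mathsf T}$, $L_k(\theta)=S_k^-(\theta)C^{\mathsf T}\Sigma_k^{-1}(\theta)$, $S_k(\theta)=S_k^-(\theta)-L_k(\theta)\Sigma_k(\theta)L_k(\theta)^{\mathsf T}$ for $k=0,\dots,N$, and $S_{k+1}^-(\theta)=A_kS_k(\theta)A_k^{\mathsf T}+G_kG_k^{\mathsf T}$ for $k=0,\dots,N-1$. *)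

theory Defs
  imports
    Complex_Main
    "Jordan_Normal_Form.Gauss_Jordan_Elimination"
    "Jordan_Normal_Form.Determinant"
begin

section \<open>Matrix notation\<close>

text \<open>\<^const>\<open>mat_inverse\<close> returns \<^const>\<open>None\<close> on singular matrices, so \<open>minv Q\<close> is meaningful only
  for invertible \<open>Q\<close>.\<close>

definition minv :: "real mat \<Rightarrow> real mat" where
  "minv Q = the (mat_inverse Q)"

definition wnorm2 :: "real mat \<Rightarrow> real vec \<Rightarrow> real" where
  "wnorm2 Q x = x \<bullet> (Q *\<^sub>v x)"

definition pos_def :: "nat \<Rightarrow> real mat \<Rightarrow> bool" where
  "pos_def n Q \<longleftrightarrow> Q \<in> carrier_mat n n \<and> transpose_mat Q = Q \<and>
     (\<forall>x \<in> carrier_vec n. x \<noteq> 0\<^sub>v n \<longrightarrow> 0 < wnorm2 Q x)"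

text \<open>The matrix with \<open>p \<times> q\<close> blocks, all of size \<open>r \<times> c\<close>, whose block \<open>(k, l)\<close> (counted from 0)
  is \<open>M k l\<close>; and the vector with \<open>p\<close> blocks of length \<open>r\<close>.\<close>

definition block_mat ::
  "nat \<Rightarrow> nat \<Rightarrow> nat \<Rightarrow> nat \<Rightarrow> (nat \<Rightarrow> nat \<Rightarrow> real mat) \<Rightarrow> real mat" where
  "block_mat p q r c M =
     mat (p * r) (q * c) (\<lambda>(i, j). M (i div r) (j div c) $$ (i mod r, j mod c))"

definition block_vec :: "nat \<Rightarrow> nat \<Rightarrow> (nat \<Rightarrow> real vec) \<Rightarrow> real vec" where
  "block_vec p r b = vec (p * r) (\<lambda>i. b (i div r) $ (i mod r))"

definition kronecker :: "real mat \<Rightarrow> real mat \<Rightarrow> real mat" where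
  "kronecker P Q = block_mat (dim_row P) (dim_col P) (dim_row Q) (dim_col Q)
     (\<lambda>k l. P $$ (k, l) \<cdot>\<^sub>m Q)"

definition block_diag :: "real mat \<Rightarrow> real mat \<Rightarrow> real mat" where
  "block_diag P Q =
     four_block_mat P (0\<^sub>m (dim_row P) (dim_col Q)) (0\<^sub>m (dim_row Q) (dim_col P)) Q"

definition append_cols :: "real mat \<Rightarrow> real mat \<Rightarrow> real mat" where
  "append_cols P Q = four_block_mat P Q (0\<^sub>m 0 (dim_col P)) (0\<^sub>m 0 (dim_col Q))"

section \<open>Quasi-linear systems\<close>

text \<open>The data of
    \<open>x\<^sub>k\<^sub>+\<^sub>1 = A(\<theta>,u\<^sub>k) x\<^sub>k + B(\<theta>,u\<^sub>k) + G(\<theta>,u\<^sub>k) w\<^sub>k\<close> for \<open>k < N\<close>, and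
    \<open>y\<^sub>k = C x\<^sub>k + v\<^sub>k\<close> for \<open>k \<le> N\<close>,
  where, given \<open>\<theta>\<close>, the variables \<open>x\<^sub>0 \<sim> N(m0 \<theta>, S0 \<theta>)\<close>, \<open>w\<^sub>k \<sim> N(0, I)\<close> and \<open>v\<^sub>k \<sim> N(0, S\<^sub>v)\<close> are
  mutually independent. An input \<open>U = col(u\<^sub>0, \<dots>, u\<^sub>N\<^sub>-\<^sub>1)\<close> is represented by a sequence
  \<open>u :: nat \<Rightarrow> real vec\<close>, of which only the values below \<open>N\<close> are used.\<close>

record quasi_linear_system =
  dim_theta :: nat
  dim_u :: nat
  dim_x :: nat
  dim_y :: nat
  dim_w :: nat
  horizon :: nat
  Theta :: "real vec set"
  Amat :: "real vec \<Rightarrow> real vec \<Rightarrow> real mat"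
  Bvec :: "real vec \<Rightarrow> real vec \<Rightarrow> real vec"
  Gmat :: "real vec \<Rightarrow> real vec \<Rightarrow> real mat"
  Cmat :: "real mat"
  Sv :: "real mat"
  m0 :: "real vec \<Rightarrow> real vec"
  S0 :: "real vec \<Rightarrow> real mat"

definition wf_system :: "quasi_linear_system \<Rightarrow> bool" where
  "wf_system \<S> \<longleftrightarrow>
     1 \<le> horizon \<S> \<and>
     Theta \<S> \<subseteq> carrier_vec (dim_theta \<S>) \<and>
     (\<forall>\<theta> \<in> Theta \<S>. \<forall>v \<in> carrier_vec (dim_u \<S>).
        Amat \<S> \<theta> v \<in> carrier_mat (dim_x \<S>) (dim_x \<S>) \<and>
        Bvec \<S> \<theta> v \<in> carrier_vec (dim_x \<S>) \<and>
        Gmat \<S> \<theta> v \<in> carrier_mat (dim_x \<S>) (dim_w \<S>)) \<and>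
     Cmat \<S> \<in> carrier_mat (dim_y \<S>) (dim_x \<S>) \<and>
     pos_def (dim_y \<S>) (Sv \<S>) \<and>
     (\<forall>\<theta> \<in> Theta \<S>. m0 \<S> \<theta> \<in> carrier_vec (dim_x \<S>) \<and> pos_def (dim_x \<S>) (S0 \<S> \<theta>))"

section \<open>Stacked form\<close>

text \<open>\<open>\<Phi>(k, j) = A\<^sub>k\<^sub>-\<^sub>1 \<cdots> A\<^sub>j\<close> for \<open>j < k\<close>, and \<open>\<Phi>(k, k) = I\<close>.\<close>

fun transition ::
  "quasi_linear_system \<Rightarrow> real vec \<Rightarrow> (nat \<Rightarrow> real vec) \<Rightarrow> nat \<Rightarrow> nat \<Rightarrow> real mat" where
  "transition \<S> \<theta> u 0 j = 1\<^sub>m (dim_x \<S>)"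
| "transition \<S> \<theta> u (Suc k) j =
     (if j \<le> k then Amat \<S> \<theta> (u k) * transition \<S> \<theta> u k j else 1\<^sub>m (dim_x \<S>))"

definition stackedA ::
  "quasi_linear_system \<Rightarrow> real vec \<Rightarrow> (nat \<Rightarrow> real vec) \<Rightarrow> real mat" where
  "stackedA \<S> \<theta> u =
     block_mat (horizon \<S> + 1) 1 (dim_x \<S>) (dim_x \<S>) (\<lambda>k _. transition \<S> \<theta> u k 0)"

definition stackedB ::
  "quasi_linear_system \<Rightarrow> real vec \<Rightarrow> (nat \<Rightarrow> real vec) \<Rightarrow> real vec" where
  "stackedB \<S> \<theta> u = block_vec (horizon \<S> + 1) (dim_x \<S>)
     (\<lambda>k. finsum_vec TYPE(real) (dim_x \<S>)
            (\<lambda>j. transition \<S> \<theta> u k (j + 1) *\<^sub>v Bvec \<S> \<theta> (u j)) {0..<k})"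

definition stackedG ::
  "quasi_linear_system \<Rightarrow> real vec \<Rightarrow> (nat \<Rightarrow> real vec) \<Rightarrow> real mat" where
  "stackedG \<S> \<theta> u =
     block_mat (horizon \<S> + 1) (horizon \<S>) (dim_x \<S>) (dim_w \<S>)
       (\<lambda>k j. if j < k then transition \<S> \<theta> u k (j + 1) * Gmat \<S> \<theta> (u j)
              else 0\<^sub>m (dim_x \<S>) (dim_w \<S>))"

definition stackedC :: "quasi_linear_system \<Rightarrow> real mat" where
  "stackedC \<S> = kronecker (1\<^sub>m (horizon \<S> + 1)) (Cmat \<S>)"

text \<open>Mean and covariance of \<open>Y = col(y\<^sub>0, \<dots>, y\<^sub>N)\<close> given \<open>\<theta>\<close>.\<close>

definition meanF ::
  "quasi_linear_system \<Rightarrow> real vec \<Rightarrow> (nat \<Rightarrow> real vec) \<Rightarrow> real vec" where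
  "meanF \<S> \<theta> u =
     (stackedC \<S> * stackedA \<S> \<theta> u) *\<^sub>v m0 \<S> \<theta> + stackedC \<S> *\<^sub>v stackedB \<S> \<theta> u"

definition covS ::
  "quasi_linear_system \<Rightarrow> real vec \<Rightarrow> (nat \<Rightarrow> real vec) \<Rightarrow> real mat" where
  "covS \<S> \<theta> u =
     stackedC \<S>
       * (stackedA \<S> \<theta> u * S0 \<S> \<theta> * transpose_mat (stackedA \<S> \<theta> u)
          + stackedG \<S> \<theta> u * transpose_mat (stackedG \<S> \<theta> u))
       * transpose_mat (stackedC \<S>)
     + kronecker (1\<^sub>m (horizon \<S> + 1)) (Sv \<S>)"

definition dist_d ::
  "quasi_linear_system \<Rightarrow> real vec \<Rightarrow> real vec \<Rightarrow> (nat \<Rightarrow> real vec) \<Rightarrow> real" where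
  "dist_d \<S> \<theta>i \<theta>j u =
     (let \<Delta> = meanF \<S> \<theta>i u - meanF \<S> \<theta>j u;
          Si = covS \<S> \<theta>i u;
          Sj = covS \<S> \<theta>j u;
          Sm = (1/2) \<cdot>\<^sub>m (Si + Sj)
      in 1/8 * wnorm2 (minv Sm) \<Delta> + 1/2 * ln (det Sm) - 1/4 * ln (det Si * det Sj))"

section \<open>Covariance recursion\<close>

text \<open>One measurement update, for output matrix \<open>C\<close>, noise covariance \<open>V\<close> and predicted state
  covariance \<open>P\<close>.\<close>

definition innov_cov :: "real mat \<Rightarrow> real mat \<Rightarrow> real mat \<Rightarrow> real mat" where
  "innov_cov C V P = V + C * P * transpose_mat C"

definition gain :: "real mat \<Rightarrow> real mat \<Rightarrow> real mat \<Rightarrow> real mat" where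
  "gain C V P = P * transpose_mat C * minv (innov_cov C V P)"

definition filt_cov :: "real mat \<Rightarrow> real mat \<Rightarrow> real mat \<Rightarrow> real mat" where
  "filt_cov C V P = P - gain C V P * innov_cov C V P * transpose_mat (gain C V P)"

text \<open>The predicted covariances \<open>S\<^sub>k\<^sup>-\<close>, for time-varying \<open>A\<close>, \<open>G\<close> and initial covariance \<open>P0\<close>.\<close>

primrec pred_cov ::
  "(nat \<Rightarrow> real mat) \<Rightarrow> (nat \<Rightarrow> real mat) \<Rightarrow> real mat \<Rightarrow> real mat \<Rightarrow> real mat \<Rightarrow> nat \<Rightarrow> real mat" where
  "pred_cov A G C V P0 0 = P0"
| "pred_cov A G C V P0 (Suc k) =
     A k * filt_cov C V (pred_cov A G C V P0 k) * transpose_mat (A k)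
     + G k * transpose_mat (G k)"

definition Sigma_k ::
  "quasi_linear_system \<Rightarrow> real vec \<Rightarrow> (nat \<Rightarrow> real vec) \<Rightarrow> nat \<Rightarrow> real mat" where
  "Sigma_k \<S> \<theta> u k =
     innov_cov (Cmat \<S>) (Sv \<S>)
       (pred_cov (\<lambda>l. Amat \<S> \<theta> (u l)) (\<lambda>l. Gmat \<S> \<theta> (u l)) (Cmat \<S>) (Sv \<S>) (S0 \<S> \<theta>) k)"

section \<open>The augmented system for a pair of parameters\<close>

definition tildeA ::
  "quasi_linear_system \<Rightarrow> real vec \<Rightarrow> real vec \<Rightarrow> (nat \<Rightarrow> real vec) \<Rightarrow> nat \<Rightarrow> real mat" where
  "tildeA \<S> \<theta>i \<theta>j u k = block_diag (Amat \<S> \<theta>i (u k)) (Amat \<S> \<theta>j (u k))"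

definition tildeB ::
  "quasi_linear_system \<Rightarrow> real vec \<Rightarrow> real vec \<Rightarrow> (nat \<Rightarrow> real vec) \<Rightarrow> nat \<Rightarrow> real vec" where
  "tildeB \<S> \<theta>i \<theta>j u k = Bvec \<S> \<theta>i (u k) @\<^sub>v Bvec \<S> \<theta>j (u k)"

definition tildeG ::
  "quasi_linear_system \<Rightarrow> real vec \<Rightarrow> real vec \<Rightarrow> (nat \<Rightarrow> real vec) \<Rightarrow> nat \<Rightarrow> real mat" where
  "tildeG \<S> \<theta>i \<theta>j u k = block_diag (Gmat \<S> \<theta>i (u k)) (Gmat \<S> \<theta>j (u k))"

definition tildeC :: "quasi_linear_system \<Rightarrow> real mat" where
  "tildeC \<S> = (1 / sqrt 2) \<cdot>\<^sub>m append_cols (Cmat \<S>) (- Cmat \<S>)"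

definition tildeS_pred ::
  "quasi_linear_system \<Rightarrow> real vec \<Rightarrow> real vec \<Rightarrow> (nat \<Rightarrow> real vec) \<Rightarrow> nat \<Rightarrow> real mat" where
  "tildeS_pred \<S> \<theta>i \<theta>j u =
     pred_cov (tildeA \<S> \<theta>i \<theta>j u) (tildeG \<S> \<theta>i \<theta>j u) (tildeC \<S>) (Sv \<S>)
       (block_diag (S0 \<S> \<theta>i) (S0 \<S> \<theta>j))"

definition tildeSigma ::
  "quasi_linear_system \<Rightarrow> real vec \<Rightarrow> real vec \<Rightarrow> (nat \<Rightarrow> real vec) \<Rightarrow> nat \<Rightarrow> real mat" where
  "tildeSigma \<S> \<theta>i \<theta>j u k = innov_cov (tildeC \<S>) (Sv \<S>) (tildeS_pred \<S> \<theta>i \<theta>j u k)"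

definition tildeL ::
  "quasi_linear_system \<Rightarrow> real vec \<Rightarrow> real vec \<Rightarrow> (nat \<Rightarrow> real vec) \<Rightarrow> nat \<Rightarrow> real mat" where
  "tildeL \<S> \<theta>i \<theta>j u k = gain (tildeC \<S>) (Sv \<S>) (tildeS_pred \<S> \<theta>i \<theta>j u k)"

primrec tildem ::
  "quasi_linear_system \<Rightarrow> real vec \<Rightarrow> real vec \<Rightarrow> (nat \<Rightarrow> real vec) \<Rightarrow> nat \<Rightarrow> real vec" where
  "tildem \<S> \<theta>i \<theta>j u 0 = m0 \<S> \<theta>i @\<^sub>v m0 \<S> \<theta>j"
| "tildem \<S> \<theta>i \<theta>j u (Suc k) =
     (tildeA \<S> \<theta>i \<theta>j u k * (1\<^sub>m (2 * dim_x \<S>) - tildeL \<S> \<theta>i \<theta>j u k * tildeC \<S>))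
       *\<^sub>v tildem \<S> \<theta>i \<theta>j u k
     + tildeB \<S> \<theta>i \<theta>j u k"

end

theory Submission
  imports Defs
begin

text \<open>The augmented system has output covariance \<open>(S\<^sub>i + S\<^sub>j)/2\<close> and output mean \<open>\<Delta>/\<surd>2\<close>, so both terms
  are read off the Gaussian density of its stacked output at \<open>0\<close>. For any linear system with
  stacked output covariance \<open>M\<close> and mean \<open>f\<close>, eliminating the first output block leaves as Schur
  complement the stacked covariance of the system started one step later from the updated
  covariance \<open>S\<^sub>1\<^sup>-\<close>; induction on the horizon gives \<open>|M| = \<Prod>|\<Sigma>\<^sub>k|\<close>. If \<open>M s = f\<close>, the same elimination
  applied to \<open>s\<close> splits \<open>f \<bullet> s\<close> into the sum of the innovation terms. Positive semidefiniteness of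
  the predicted covariances, needed to invert \<open>\<Sigma>\<^sub>k\<close>, comes from the Joseph form
  \<open>(I - L C) P (I - L C)\<^sup>T + L V L\<^sup>T\<close> of the measurement update.\<close>

text \<open>The halves of the augmented state start uncorrelated, but in general an update through
  \<open>tildeC\<close> correlates them. The augmented filter is therefore not assembled from the
  filters for \<theta>i and \<theta>j, and the recursions cannot be compared step by step. They are
  compared only through stacked outputs, whose covariances involve no update: there the
  block-diagonal dynamics and the row [C -C]/sqrt 2 average two covariances, and two copies of
  \<open>Sv\<close> average back to \<open>Sv\<close>. The filter appends its newest step at the
  end, while elimination removes the oldest output. Hence outputs are described anew by recursion on
  the first step with shifted coefficients. Two translations are the price: a time shift of the
  filter recursions, and agreement with the stacked matrices of the statement. Evaluation at 0 makes
  every innovation equal to - C m, which is why the mean recursion carries I - L C and no data. The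
  scale 1/sqrt 2 enters the quadratic form twice and turns the coefficient 1/4 into the 1/8 of
  \<open>dist_d\<close>.\<close>

section \<open>Matrix and vector algebra with dimension equations as side conditions\<close>

lemma mat_mult_assoc:
  fixes X :: "real mat"
  assumes "dim_col X = dim_row Y" "dim_col Y = dim_row Z"
  shows "X * Y * Z = X * (Y * Z)"
  using assms by (intro assoc_mult_mat) (auto intro!: carrier_matI)

lemma mat_mult_add_left:
  fixes X :: "real mat"
  assumes "dim_row X = dim_row Y" "dim_col X = dim_col Y" "dim_col X = dim_row Z"
  shows "(X + Y) * Z = X * Z + Y * Z"
  using assms by (intro add_mult_distrib_mat[of _ "dim_row X" "dim_col X"]) (auto intro!: carrier_matI)

lemma mat_mult_add_right:
  fixes X :: "real mat"
  assumes "dim_row Y = dim_row X" "dim_col Y = dim_col X" "dim_col Z = dim_row X"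
  shows "Z * (X + Y) = Z * X + Z * Y"
  using assms by (intro mult_add_distrib_mat[of _ "dim_row Z" "dim_col Z"]) (auto intro!: carrier_matI)

lemma mat_mult_minus_left:
  fixes X :: "real mat"
  assumes "dim_row X = dim_row Y" "dim_col X = dim_col Y" "dim_col X = dim_row Z"
  shows "(X - Y) * Z = X * Z - Y * Z"
  using assms by (intro minus_mult_distrib_mat[of _ "dim_row X" "dim_col X"]) (auto intro!: carrier_matI)

lemma mat_mult_minus_right:
  fixes X :: "real mat"
  assumes "dim_row Y = dim_row X" "dim_col Y = dim_col X" "dim_col Z = dim_row X"
  shows "Z * (X - Y) = Z * X - Z * Y"
  using assms by (intro mult_minus_distrib_mat[of _ "dim_row Z" "dim_col Z"]) (auto intro!: carrier_matI)

lemma mat_transpose_mult: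
  fixes X :: "real mat"
  assumes "dim_col X = dim_row Y"
  shows "transpose_mat (X * Y) = transpose_mat Y * transpose_mat X"
  using assms by (intro transpose_mult) (auto intro!: carrier_matI)

lemma mat_transpose_add:
  fixes X :: "real mat"
  assumes "dim_row X = dim_row Y" "dim_col X = dim_col Y"
  shows "transpose_mat (X + Y) = transpose_mat X + transpose_mat Y"
  using assms by (intro transpose_add) (auto intro!: carrier_matI)

lemma mat_transpose_minus:
  fixes X :: "real mat"
  assumes "dim_row X = dim_row Y" "dim_col X = dim_col Y"
  shows "transpose_mat (X - Y) = transpose_mat X - transpose_mat Y"
  using assms by (intro transpose_minus) (auto intro!: carrier_matI)

lemma mat_mult_vec_assoc:
  fixes X :: "real mat"
  assumes "dim_col X = dim_row Y" "dim_col Y = dim_vec x"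
  shows "(X * Y) *\<^sub>v x = X *\<^sub>v (Y *\<^sub>v x)"
  using assms by (intro assoc_mult_mat_vec) (auto intro!: carrier_matI carrier_vecI)

lemma mat_vec_add_left:
  fixes X :: "real mat"
  assumes "dim_row X = dim_row Y" "dim_col X = dim_col Y" "dim_col X = dim_vec x"
  shows "(X + Y) *\<^sub>v x = X *\<^sub>v x + Y *\<^sub>v x"
  using assms by (intro add_mult_distrib_mat_vec) (auto intro!: carrier_matI carrier_vecI)

lemma mat_vec_add_right:
  fixes X :: "real mat"
  assumes "dim_vec y = dim_vec x" "dim_col X = dim_vec x"
  shows "X *\<^sub>v (x + y) = X *\<^sub>v x + X *\<^sub>v y"
  using assms by (intro mult_add_distrib_mat_vec) (auto intro!: carrier_matI carrier_vecI)

lemma mat_vec_minus_left: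
  fixes X :: "real mat"
  assumes "dim_row X = dim_row Y" "dim_col X = dim_col Y" "dim_col X = dim_vec x"
  shows "(X - Y) *\<^sub>v x = X *\<^sub>v x - Y *\<^sub>v x"
  using assms by (intro minus_mult_distrib_mat_vec) (auto intro!: carrier_matI carrier_vecI)

lemma mat_vec_minus_right:
  fixes X :: "real mat"
  assumes "dim_vec y = dim_vec x" "dim_col X = dim_vec x"
  shows "X *\<^sub>v (x - y) = X *\<^sub>v x - X *\<^sub>v y"
  using assms by (intro mult_minus_distrib_mat_vec) (auto intro!: carrier_matI carrier_vecI)

text \<open>These rules expand products of sums into right-associated monomials with transposes at
  the leaves. Their premises are dimension equations, which \<open>simp\<close> can evaluate; with
  carrier premises it would have to guess the inner dimensions. The remaining rearrangement of
  summands is left to a comparison of entries, that is, to real arithmetic.\<close>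

lemmas mat_expand = mat_mult_assoc mat_mult_add_left mat_mult_add_right mat_mult_minus_left
  mat_mult_minus_right mat_transpose_mult mat_transpose_add mat_transpose_minus

lemmas mat_vec_expand = mat_mult_vec_assoc mat_vec_add_left mat_vec_add_right
  mat_vec_minus_left mat_vec_minus_right

lemma scalar_prod_mult_vec:
  fixes X :: "real mat"
  assumes "dim_row X = dim_vec x" "dim_col X = dim_vec y"
  shows "x \<bullet> (X *\<^sub>v y) = (transpose_mat X *\<^sub>v x) \<bullet> y"
  by (rule transpose_vec_mult_scalar[symmetric, of _ "dim_row X" "dim_col X"])
     (use assms in \<open>auto intro!: carrier_vecI\<close>)

lemma append_rows_mult:
  fixes X :: "real mat"
  assumes "X \<in> carrier_mat p n" "Y \<in> carrier_mat q n" "Z \<in> carrier_mat n m"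
  shows "(X @\<^sub>r Y) * Z = X * Z @\<^sub>r Y * Z"
proof -
  \<comment> \<open>\<open>@\<^sub>r\<close> is a four-block matrix whose right blocks have width 0,
    so \<open>Z\<close> is padded by empty blocks until \<open>mult_four_block_mat\<close>
    fits.\<close>
  have "Z = four_block_mat Z (0\<^sub>m n 0) (0\<^sub>m 0 m) (0\<^sub>m 0 0)"
    using assms by (intro eq_matI) auto
  then have "(X @\<^sub>r Y) * Z = (X @\<^sub>r Y) * \<dots>" by simp
  also have "\<dots> = X * Z @\<^sub>r Y * Z"
    unfolding append_rows_def
    by (subst mult_four_block_mat[of _ p n _ 0 _ q _ _ m _ 0]) (use assms in auto)
  finally show ?thesis .
qed

lemma append_rows_mult_transpose:
  fixes X :: "real mat"
  assumes "X \<in> carrier_mat p n" "Y \<in> carrier_mat q n" "X' \<in> carrier_mat p' n" "Y' \<in> carrier_mat q' n"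
  shows "(X @\<^sub>r Y) * transpose_mat (X' @\<^sub>r Y')
    = four_block_mat (X * transpose_mat X') (X * transpose_mat Y')
        (Y * transpose_mat X') (Y * transpose_mat Y')"
proof -
  have "transpose_mat (X' @\<^sub>r Y')
    = four_block_mat (transpose_mat X') (transpose_mat Y') (0\<^sub>m 0 p') (0\<^sub>m 0 q')"
    unfolding append_rows_def
    by (subst transpose_four_block_mat[of _ p' n _ 0 _ q']) (use assms in auto)
  then show ?thesis
    unfolding append_rows_def
    by (simp only:, subst mult_four_block_mat[of _ p n _ 0 _ q _ _ p' _ q']) (use assms in auto)
qed

section \<open>Positive semidefinite matrices\<close>

definition pos_semidef :: "nat \<Rightarrow> real mat \<Rightarrow> bool" where
  "pos_semidef n Q \<longleftrightarrow> Q \<in> carrier_mat n n \<and> transpose_mat Q = Q \<and>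
     (\<forall>x \<in> carrier_vec n. 0 \<le> wnorm2 Q x)"

lemma pos_semidefD:
  assumes "pos_semidef n Q"
  shows "Q \<in> carrier_mat n n" "transpose_mat Q = Q" "dim_row Q = n" "dim_col Q = n"
  using assms by (auto simp: pos_semidef_def)

lemma pos_defD:
  assumes "pos_def n Q"
  shows "Q \<in> carrier_mat n n" "transpose_mat Q = Q" "dim_row Q = n" "dim_col Q = n"
  using assms by (auto simp: pos_def_def)

lemma pos_def_imp_pos_semidef: "pos_def n Q \<Longrightarrow> pos_semidef n Q"
  unfolding pos_def_def pos_semidef_def
  by (metis less_eq_real_def mult_mat_vec_carrier scalar_prod_left_zero wnorm2_def)

lemma pos_semidef_congruence:
  assumes P: "pos_semidef n P" and M: "M \<in> carrier_mat m n"
  shows "pos_semidef m (M * P * transpose_mat M)"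
proof -
  note d = pos_semidefD[OF P] carrier_matD[OF M]
  have "0 \<le> wnorm2 (M * P * transpose_mat M) x" if x: "x \<in> carrier_vec m" for x
  proof -
    have "wnorm2 (M * P * transpose_mat M) x = wnorm2 P (transpose_mat M *\<^sub>v x)"
      using x d by (simp add: wnorm2_def mat_mult_vec_assoc mat_mult_assoc scalar_prod_mult_vec)
    moreover have "transpose_mat M *\<^sub>v x \<in> carrier_vec n" using d by (intro carrier_vecI) simp
    ultimately show ?thesis using P by (simp add: pos_semidef_def)
  qed
  then show ?thesis
    using d M by (auto simp: pos_semidef_def mat_transpose_mult mat_mult_assoc)
qed

lemma pos_semidef_gram:
  assumes "M \<in> carrier_mat m n"
  shows "pos_semidef m (M * transpose_mat M)"
proof -
  have "pos_semidef n (1\<^sub>m n)"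
    by (auto simp: pos_semidef_def wnorm2_def scalar_prod_def intro!: sum_nonneg)
  from pos_semidef_congruence[OF this assms] show ?thesis using assms by simp
qed

lemma wnorm2_add:
  assumes "P \<in> carrier_mat n n" "Q \<in> carrier_mat n n" "x \<in> carrier_vec n"
  shows "wnorm2 (P + Q) x = wnorm2 P x + wnorm2 Q x"
  using assms by (simp add: wnorm2_def mat_vec_add_left scalar_prod_add_distrib[of _ n])

lemma pos_semidef_add:
  assumes "pos_semidef n P" "pos_semidef n Q"
  shows "pos_semidef n (P + Q)"
  using assms by (auto simp: pos_semidef_def wnorm2_add mat_transpose_add)

lemma pos_def_add_pos_semidef:
  assumes "pos_def n P" "pos_semidef n Q"
  shows "pos_def n (P + Q)"
  using assms by (auto simp: pos_semidef_def pos_def_def wnorm2_add mat_transpose_add add_pos_nonneg)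

lemma pos_def_det_nonzero:
  assumes "pos_def n Q"
  shows "det Q \<noteq> 0"
proof
  assume "det Q = 0"
  then obtain v where "v \<in> carrier_vec n" "v \<noteq> 0\<^sub>v n" "Q *\<^sub>v v = 0\<^sub>v n"
    using det_0_iff_vec_prod_zero[OF pos_defD(1)[OF assms]] by auto
  then show False using assms by (force simp: pos_def_def wnorm2_def)
qed

lemma minv_inverse:
  assumes "Q \<in> carrier_mat n n" "det Q \<noteq> 0"
  shows "minv Q \<in> carrier_mat n n" "Q * minv Q = 1\<^sub>m n" "minv Q * Q = 1\<^sub>m n"
proof -
  \<comment> \<open>The \<open>()\<close> fills the record extension slot of
    \<open>ring_mat\<close>, the ring in whose units invertibility is expressed.\<close>
  have "mat_inverse Q \<noteq> None"
    using mat_inverse(1)[OF assms(1), where b = "()"] det_non_zero_imp_unit[OF assms, of "()"]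
    by blast
  then have "mat_inverse Q = Some (minv Q)" by (auto simp: minv_def)
  from mat_inverse(2)[OF assms(1) this]
  show "minv Q \<in> carrier_mat n n" "Q * minv Q = 1\<^sub>m n" "minv Q * Q = 1\<^sub>m n" by auto
qed

lemma minv_solve:
  assumes "Q \<in> carrier_mat n n" "det Q \<noteq> 0" "x \<in> carrier_vec n" "Q *\<^sub>v x = y"
  shows "minv Q *\<^sub>v y = x"
  using minv_inverse[OF assms(1,2)] assms
  by (metis assoc_mult_mat_vec one_mult_mat_vec)

section \<open>Block LDL factorisation\<close>

text \<open>The matrix is the unit lower triangular [I 0; K I] times the upper triangular
  [D, D K^T; 0, S], and \<open>S\<close> is its Schur complement. Writing the off-diagonal block as
  \<open>K * D\<close> exhibits the factorisation without an inverse of \<open>D\<close>.\<close>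

lemma det_block_ldl:
  fixes D :: "real mat"
  assumes "D \<in> carrier_mat p p" "S \<in> carrier_mat q q" "K \<in> carrier_mat q p"
  shows "det (four_block_mat D (D * transpose_mat K) (K * D) (S + K * D * transpose_mat K))
           = det D * det S"
proof -
  have "four_block_mat D (D * transpose_mat K) (K * D) (S + K * D * transpose_mat K)
      = four_block_mat (1\<^sub>m p) (0\<^sub>m p q) K (1\<^sub>m q)
        * four_block_mat D (D * transpose_mat K) (0\<^sub>m q p) S"
    using assms
    by (subst mult_four_block_mat[of _ p p _ q _ q _ _ p _ q])
       (auto simp: mat_mult_assoc comm_add_mat[of S q q "K * (D * transpose_mat K)"])
  moreover have "det (four_block_mat (1\<^sub>m p) (0\<^sub>m p q) K (1\<^sub>m q)) = 1"
    using assms by (subst det_four_block_mat_upper_right_zero[of _ p _ q]) auto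
  moreover have "det (four_block_mat D (D * transpose_mat K) (0\<^sub>m q p) S) = det D * det S"
    using assms by (intro det_four_block_mat_lower_left_zero[of _ p _ q]) auto
  ultimately show ?thesis using assms by (simp add: det_mult[of _ "p + q"])
qed

text \<open>With E = [I 0; K I] the matrix is E diag(D, S) E^T and the right-hand side is E applied
  to (f, g). Cancelling E leaves two decoupled systems for E^T s, and moving E across the scalar
  product gives (f, g) paired with E^T s.\<close>

lemma block_ldl_solution:
  fixes D :: "real mat"
  assumes D: "D \<in> carrier_mat p p" and S: "S \<in> carrier_mat q q" and K: "K \<in> carrier_mat q p"
    and f: "f \<in> carrier_vec p" and g: "g \<in> carrier_vec q" and s: "s \<in> carrier_vec (p + q)"
    and eq: "four_block_mat D (D * transpose_mat K) (K * D) (S + K * D * transpose_mat K) *\<^sub>v s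
      = f @\<^sub>v (g + K *\<^sub>v f)"
  obtains t w where "t \<in> carrier_vec p" "w \<in> carrier_vec q" "D *\<^sub>v t = f" "S *\<^sub>v w = g"
    "(f @\<^sub>v (g + K *\<^sub>v f)) \<bullet> s = f \<bullet> t + g \<bullet> w"
proof -
  define s0 w where "s0 = vec_first s p" and "w = vec_last s q"
  have s0: "s0 \<in> carrier_vec p" and w: "w \<in> carrier_vec q" and s_eq: "s = s0 @\<^sub>v w"
    using s by (auto simp: s0_def w_def)
  \<comment> \<open>(t, w) is E^T applied to s: only the first block changes.\<close>
  define t where "t = s0 + transpose_mat K *\<^sub>v w"
  have t: "t \<in> carrier_vec p" using s0 K w by (auto simp: t_def)
  note d = carrier_matD[OF D] carrier_matD[OF S] carrier_matD[OF K] carrier_vecD[OF f]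
    carrier_vecD[OF g] carrier_vecD[OF s0] carrier_vecD[OF w]
  have "four_block_mat D (D * transpose_mat K) (K * D) (S + K * D * transpose_mat K) *\<^sub>v s
      = (D *\<^sub>v s0 + (D * transpose_mat K) *\<^sub>v w)
        @\<^sub>v ((K * D) *\<^sub>v s0 + (S + K * D * transpose_mat K) *\<^sub>v w)"
    unfolding s_eq using D S K s0 w by (intro four_block_mat_mult_vec[of _ p p _ q _ q]) auto
  with eq have "f @\<^sub>v (g + K *\<^sub>v f) = \<dots>" by simp
  moreover have "D *\<^sub>v s0 + (D * transpose_mat K) *\<^sub>v w \<in> carrier_vec p"
    using D K s0 w by auto
  ultimately have 1: "f = D *\<^sub>v s0 + (D * transpose_mat K) *\<^sub>v w"
    and 2: "g + K *\<^sub>v f = (K * D) *\<^sub>v s0 + (S + K * D * transpose_mat K) *\<^sub>v w"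
    using append_vec_eq[OF f] by blast+
  have Dt: "D *\<^sub>v t = f" unfolding 1 using d by (simp add: t_def mat_vec_expand)
  have "g + K *\<^sub>v f = S *\<^sub>v w + K *\<^sub>v (D *\<^sub>v t)"
    unfolding 2 t_def using d by (intro eq_vecI) (simp_all add: mat_vec_expand mat_mult_assoc)
  then have "g + K *\<^sub>v f = S *\<^sub>v w + K *\<^sub>v f" unfolding Dt .
  then have Sw: "S *\<^sub>v w = g"
    using d by (auto simp: vec_eq_iff)
  have "(f @\<^sub>v (g + K *\<^sub>v f)) \<bullet> s = f \<bullet> s0 + (g + K *\<^sub>v f) \<bullet> w"
    unfolding s_eq using f s0 g w K by (intro scalar_prod_append[of _ p _ q]) auto
  also have "(g + K *\<^sub>v f) \<bullet> w = g \<bullet> w + f \<bullet> (transpose_mat K *\<^sub>v w)"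
    using f g w K by (subst scalar_prod_mult_vec) (auto simp: add_scalar_prod_distrib[of _ q])
  also have "f \<bullet> s0 + \<dots> = f \<bullet> t + g \<bullet> w"
    unfolding t_def using f s0 K w by (subst scalar_prod_add_distrib[of _ p]) auto
  finally show thesis using that[OF t w Dt Sw] by simp
qed

section \<open>Gaussian output of a time-varying linear system\<close>

text \<open>The observability matrix, with block rows C A_(k-1) ... A_0. Like the two functions that
  follow, it peels off time 0 and shifts the coefficients, because eliminating the first output
  restarts the system at time 1.\<close>

primrec out_map :: "real mat \<Rightarrow> (nat \<Rightarrow> real mat) \<Rightarrow> nat \<Rightarrow> real mat" where
  "out_map C A 0 = C"
| "out_map C A (Suc N) = C @\<^sub>r (out_map C (\<lambda>k. A (Suc k)) N * A 0)"

primrec out_mean ::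
  "real mat \<Rightarrow> (nat \<Rightarrow> real mat) \<Rightarrow> (nat \<Rightarrow> real vec) \<Rightarrow> real vec \<Rightarrow> nat \<Rightarrow> real vec" where
  "out_mean C A B m 0 = C *\<^sub>v m"
| "out_mean C A B m (Suc N) =
     (C *\<^sub>v m) @\<^sub>v out_mean C (\<lambda>k. A (Suc k)) (\<lambda>k. B (Suc k)) (A 0 *\<^sub>v m + B 0) N"

text \<open>The off-diagonal blocks are the covariances of y_0 with the later outputs: these depend
  on x_0 through \<open>H\<close>, and all noises are independent of x_0 and of each other. The last
  block starts from the unconditional covariance of x_1, before any measurement update.\<close>

primrec out_cov ::
  "real mat \<Rightarrow> real mat \<Rightarrow> (nat \<Rightarrow> real mat) \<Rightarrow> (nat \<Rightarrow> real mat) \<Rightarrow> real mat \<Rightarrow> nat \<Rightarrow> real mat" where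
  "out_cov C V A G P 0 = innov_cov C V P"
| "out_cov C V A G P (Suc N) =
     (let H = out_map C (\<lambda>k. A (Suc k)) N * A 0 in
      four_block_mat (innov_cov C V P) (C * P * transpose_mat H) (H * P * transpose_mat C)
        (out_cov C V (\<lambda>k. A (Suc k)) (\<lambda>k. G (Suc k))
           (A 0 * P * transpose_mat (A 0) + G 0 * transpose_mat (G 0)) N))"

text \<open>The Kalman predictor run on the observations \<open>y\<^sub>k = 0\<close>.\<close>

primrec pred_mean ::
  "(nat \<Rightarrow> real mat) \<Rightarrow> (nat \<Rightarrow> real vec) \<Rightarrow> (nat \<Rightarrow> real mat) \<Rightarrow> real mat \<Rightarrow> real mat \<Rightarrow> real mat
    \<Rightarrow> real vec \<Rightarrow> nat \<Rightarrow> real vec" where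
  "pred_mean A B G C V P m 0 = m"
| "pred_mean A B G C V P m (Suc k) =
     (A k * (1\<^sub>m (dim_col C) - gain C V (pred_cov A G C V P k) * C)) *\<^sub>v pred_mean A B G C V P m k
     + B k"

text \<open>\<open>pred_cov\<close> unrolls at its last step, the inductions over outputs at the
  first. This restarts the filter at time 1, so that the induction hypothesis speaks of its later
  values.\<close>

lemma pred_cov_shift:
  "pred_cov A G C V P (Suc k)
     = pred_cov (\<lambda>k. A (Suc k)) (\<lambda>k. G (Suc k)) C V (pred_cov A G C V P 1) k"
  by (induction k) simp_all

lemma pred_mean_shift:
  "pred_mean A B G C V P m (Suc k)
     = pred_mean (\<lambda>k. A (Suc k)) (\<lambda>k. B (Suc k)) (\<lambda>k. G (Suc k)) C V (pred_cov A G C V P 1)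
         (pred_mean A B G C V P m 1) k"
proof (induction k)
  case (Suc k)
  have "pred_mean A B G C V P m (Suc (Suc k))
    = (A (Suc k) * (1\<^sub>m (dim_col C) - gain C V (pred_cov A G C V P (Suc k)) * C))
        *\<^sub>v pred_mean A B G C V P m (Suc k) + B (Suc k)"
    by (rule pred_mean.simps)
  then show ?case unfolding Suc.IH pred_cov_shift[of A G C V P k] by simp
qed simp

text \<open>Only \<open>C\<close> and \<open>V\<close> stay fixed: the dynamics and the initial data
  change at every induction step. The locale is interpreted twice, for the given system and for the
  augmented one.\<close>

locale observation =
  fixes n r :: nat and C V :: "real mat"
  assumes C: "C \<in> carrier_mat r n" and V: "pos_def r V"
begin

lemma dims: "dim_row C = r" "dim_col C = n" "dim_row V = r" "dim_col V = r"
  using C V by (auto dest: pos_defD)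

section \<open>One measurement update\<close>

lemma innov_cov_pos_def:
  assumes "pos_semidef n P"
  shows "pos_def r (innov_cov C V P)"
  unfolding innov_cov_def
  by (rule pos_def_add_pos_semidef[OF V pos_semidef_congruence[OF assms C]])

lemma gain_carrier:
  assumes P: "pos_semidef n P"
  shows "gain C V P \<in> carrier_mat n r"
proof -
  note S = innov_cov_pos_def[OF P]
  have "minv (innov_cov C V P) \<in> carrier_mat r r"
    by (rule minv_inverse(1)[OF pos_defD(1)[OF S] pos_def_det_nonzero[OF S]])
  then show ?thesis
    unfolding gain_def using C pos_semidefD[OF P] by (auto intro!: mult_carrier_mat[of _ n r])
qed

text \<open>These identities take the place of the definition of the gain in later computations, so
  that no inverse has to be manipulated. The second is the transpose of the first, as P and the
  innovation covariance are symmetric.\<close>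

lemma gain_mult_innov_cov:
  assumes P: "pos_semidef n P"
  shows "gain C V P * innov_cov C V P = P * transpose_mat C"
    and "innov_cov C V P * transpose_mat (gain C V P) = C * P"
proof -
  note S = innov_cov_pos_def[OF P]
  note i = minv_inverse[OF pos_defD(1)[OF S] pos_def_det_nonzero[OF S]]
  note d = dims pos_semidefD[OF P] pos_defD[OF S] carrier_matD[OF i(1)]
  have "gain C V P * innov_cov C V P
      = P * transpose_mat C * (minv (innov_cov C V P) * innov_cov C V P)"
    unfolding gain_def by (rule mat_mult_assoc) (use d in auto)
  also have "\<dots> = P * transpose_mat C" unfolding i(3) using d by simp
  finally show 1: "gain C V P * innov_cov C V P = P * transpose_mat C" .
  have "innov_cov C V P * transpose_mat (gain C V P) = transpose_mat (gain C V P * innov_cov C V P)"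
    using d carrier_matD[OF gain_carrier[OF P]] by (subst mat_transpose_mult) auto
  also have "\<dots> = C * P" unfolding 1 using d by (simp add: mat_transpose_mult)
  finally show "innov_cov C V P * transpose_mat (gain C V P) = C * P" .
qed

text \<open>Write D for the innovation covariance. By the gain identities both L C P and P C^T L^T
  equal L D L^T, and the term quadratic in L is L D L^T - L V L^T. The congruence thus expands to P
  - L D L^T - L V L^T, and the added L V L^T cancels the last term.\<close>

lemma filt_cov_Joseph:
  assumes P: "pos_semidef n P"
  defines "L \<equiv> gain C V P"
  shows "filt_cov C V P = (1\<^sub>m n - L * C) * P * transpose_mat (1\<^sub>m n - L * C) + L * V * transpose_mat L"
proof -
  have L: "L \<in> carrier_mat n r" unfolding L_def by (rule gain_carrier[OF P])
  note d = dims pos_semidefD[OF P] carrier_matD[OF L]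
  note g = gain_mult_innov_cov[OF P, folded L_def]
  have 1: "L * C * P * transpose_mat C * transpose_mat L
    = L * innov_cov C V P * transpose_mat L - L * V * transpose_mat L"
    unfolding innov_cov_def using d by (intro eq_matI) (simp_all add: mat_expand)
  have 2: "L * C * P = L * innov_cov C V P * transpose_mat L"
    using d g(2) by (simp add: mat_mult_assoc innov_cov_def)
  have 3: "P * transpose_mat C * transpose_mat L = L * innov_cov C V P * transpose_mat L"
    using g(1) by simp
  have "(1\<^sub>m n - L * C) * P * transpose_mat (1\<^sub>m n - L * C)
    = P - P * transpose_mat C * transpose_mat L - L * C * P
      + L * C * P * transpose_mat C * transpose_mat L"
    using d by (intro eq_matI) (simp_all add: mat_expand)
  \<comment> \<open>\<open>1\<close> has to be rewritten before \<open>2\<close>, because its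
    left-hand side contains that of \<open>2\<close>.\<close>
  also have "\<dots> = P - L * innov_cov C V P * transpose_mat L - L * V * transpose_mat L"
    unfolding 1 unfolding 2 3 using d by (intro eq_matI) (simp_all add: innov_cov_def)
  finally show ?thesis
    using d unfolding filt_cov_def L_def[symmetric] by (intro eq_matI) (simp_all add: innov_cov_def)
qed

lemma filt_cov_pos_semidef:
  assumes P: "pos_semidef n P"
  shows "pos_semidef n (filt_cov C V P)"
proof -
  have L: "gain C V P \<in> carrier_mat n r" by (rule gain_carrier[OF P])
  have "1\<^sub>m n - gain C V P * C \<in> carrier_mat n n" using C L by auto
  then show ?thesis
    unfolding filt_cov_Joseph[OF P]
    by (intro pos_semidef_add pos_semidef_congruence[OF P]
        pos_semidef_congruence[OF pos_def_imp_pos_semidef[OF V] L])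
qed

lemma pred_cov_pos_semidef:
  assumes "pos_semidef n P"
    and "\<And>k. k < N \<Longrightarrow> A k \<in> carrier_mat n n" "\<And>k. k < N \<Longrightarrow> G k \<in> carrier_mat n q"
  shows "k \<le> N \<Longrightarrow> pos_semidef n (pred_cov A G C V P k)"
proof (induction k)
  case (Suc k)
  then show ?case
    using assms(2,3)[of k]
    by (auto intro!: pos_semidef_add pos_semidef_congruence[of n _ _ n] pos_semidef_gram filt_cov_pos_semidef)
qed (use assms in auto)

section \<open>Stacked outputs as functions of the initial mean and covariance\<close>

lemma out_map_carrier:
  assumes "\<And>k. k < N \<Longrightarrow> A k \<in> carrier_mat n n"
  shows "out_map C A N \<in> carrier_mat (Suc N * r) n"
  using assms
proof (induction N arbitrary: A)
  case (Suc N)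
  have "out_map C (\<lambda>k. A (Suc k)) N \<in> carrier_mat (Suc N * r) n" using Suc by simp
  then have "out_map C (\<lambda>k. A (Suc k)) N * A 0 \<in> carrier_mat (Suc N * r) n"
    using Suc.prems[of 0] by simp
  from carrier_append_rows[OF C this] show ?case by simp
qed (use C in simp)

lemma out_mean_carrier:
  "out_mean C A B m N \<in> carrier_vec (Suc N * r)"
proof (induction N arbitrary: A B m)
  case 0 then show ?case using dims by (auto intro: carrier_vecI)
next
  case (Suc N)
  have "C *\<^sub>v m \<in> carrier_vec r" using dims by (auto intro: carrier_vecI)
  from append_carrier_vec[OF this Suc] show ?case by simp
qed

lemma out_cov_carrier: "out_cov C V A G P N \<in> carrier_mat (Suc N * r) (Suc N * r)"
proof (induction N arbitrary: A G P)
  case 0 then show ?case using dims by (auto simp: innov_cov_def)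
next
  case (Suc N)
  have "innov_cov C V P \<in> carrier_mat r r" using dims by (auto simp: innov_cov_def)
  from four_block_carrier_mat[OF this Suc] show ?case by (simp add: Let_def)
qed

text \<open>The mean is affine in the initial mean with linear part \<open>out_map\<close>.
  Elimination uses this with \<open>d = A 0 *\<^sub>v (L *\<^sub>v (C *\<^sub>v m))\<close>, the
  difference between the unconditional and the predicted mean at time 1.\<close>

lemma out_mean_add:
  assumes "\<And>k. k < N \<Longrightarrow> A k \<in> carrier_mat n n" "\<And>k. k < N \<Longrightarrow> B k \<in> carrier_vec n"
    and "m \<in> carrier_vec n" "d \<in> carrier_vec n"
  shows "out_mean C A B (m + d) N = out_mean C A B m N + out_map C A N *\<^sub>v d"
  using assms
proof (induction N arbitrary: A B m d)
  case 0
  then show ?case using C by (simp add: mult_add_distrib_mat_vec)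
next
  case (Suc N)
  let ?A = "\<lambda>k. A (Suc k)" and ?B = "\<lambda>k. B (Suc k)"
  have A0: "A 0 \<in> carrier_mat n n" and B0: "B 0 \<in> carrier_vec n" using Suc.prems(1,2)[of 0] by auto
  have H: "out_map C ?A N \<in> carrier_mat (Suc N * r) n" using Suc.prems(1) by (intro out_map_carrier) simp
  note d = dims carrier_matD[OF A0] carrier_vecD[OF B0] carrier_matD[OF H]
    carrier_vecD[OF Suc.prems(3)] carrier_vecD[OF Suc.prems(4)]
  have IH: "out_mean C ?A ?B (m' + d') N = out_mean C ?A ?B m' N + out_map C ?A N *\<^sub>v d'"
    if "m' \<in> carrier_vec n" "d' \<in> carrier_vec n" for m' d'
    using Suc.IH[of ?A ?B m' d'] Suc.prems that by simp
  have "A 0 *\<^sub>v (m + d) + B 0 = (A 0 *\<^sub>v m + B 0) + A 0 *\<^sub>v d"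
    using A0 B0 Suc.prems(3,4) by (intro eq_vecI) (auto simp: mult_add_distrib_mat_vec[of _ n n])
  moreover have "out_mean C ?A ?B ((A 0 *\<^sub>v m + B 0) + A 0 *\<^sub>v d) N
      = out_mean C ?A ?B (A 0 *\<^sub>v m + B 0) N + out_map C ?A N *\<^sub>v (A 0 *\<^sub>v d)"
    using A0 B0 Suc.prems(3,4) by (intro IH) auto
  moreover have "C *\<^sub>v (m + d) = C *\<^sub>v m + C *\<^sub>v d"
    using C Suc.prems(3,4) by (simp add: mult_add_distrib_mat_vec)
  ultimately have "out_mean C A B (m + d) (Suc N)
    = (C *\<^sub>v m + C *\<^sub>v d) @\<^sub>v
      (out_mean C ?A ?B (A 0 *\<^sub>v m + B 0) N + out_map C ?A N *\<^sub>v (A 0 *\<^sub>v d))"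
    by simp
  also have "\<dots> = out_mean C A B m (Suc N)
      + ((C *\<^sub>v d) @\<^sub>v ((out_map C ?A N * A 0) *\<^sub>v d))"
    using d out_mean_carrier
    by (subst append_vec_add[symmetric, of _ r _ _ "Suc N * r"])
       (auto simp: mat_mult_vec_assoc intro!: carrier_vecI)
  also have "(C *\<^sub>v d) @\<^sub>v ((out_map C ?A N * A 0) *\<^sub>v d) = out_map C A (Suc N) *\<^sub>v d"
    using A0 C H Suc.prems by (subst out_map.simps, subst mat_mult_append[of _ r n _ "Suc N * r"]) auto
  finally show ?case .
qed

text \<open>Extra initial covariance reaches the outputs through \<open>out_map\<close> alone; the
  contributions of \<open>G\<close> and \<open>V\<close> stay in the first summand. Elimination uses
  this for the part of the covariance of x_1 that observing y_0 removes.\<close>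

lemma out_cov_add:
  assumes "\<And>k. k < N \<Longrightarrow> A k \<in> carrier_mat n n" "\<And>k. k < N \<Longrightarrow> G k \<in> carrier_mat n q"
    and "P \<in> carrier_mat n n" "Q \<in> carrier_mat n n"
  shows "out_cov C V A G (P + Q) N
    = out_cov C V A G P N + out_map C A N * Q * transpose_mat (out_map C A N)"
  using assms
proof (induction N arbitrary: A G P Q)
  case 0
  then show ?case using dims by (intro eq_matI) (auto simp: innov_cov_def mat_expand)
next
  case (Suc N)
  let ?A = "\<lambda>k. A (Suc k)" and ?G = "\<lambda>k. G (Suc k)" and ?m = "Suc N * r"
  define H where "H = out_map C ?A N"
  define R where "R P = A 0 * P * transpose_mat (A 0) + G 0 * transpose_mat (G 0)" for P
  have A0: "A 0 \<in> carrier_mat n n" and G0: "G 0 \<in> carrier_mat n q" using Suc.prems(1,2)[of 0] by auto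
  have H: "H \<in> carrier_mat ?m n" unfolding H_def using Suc.prems(1) by (intro out_map_carrier) simp
  define K where "K = H * A 0"
  have K: "K \<in> carrier_mat ?m n" unfolding K_def using H A0 by simp
  note d = dims carrier_matD[OF A0] carrier_matD[OF G0] carrier_matD[OF H] carrier_matD[OF K]
    carrier_matD[OF Suc.prems(3)] carrier_matD[OF Suc.prems(4)]
  have R: "R P \<in> carrier_mat n n" using d by (auto simp: R_def)
  have Q': "A 0 * Q * transpose_mat (A 0) \<in> carrier_mat n n" using d by auto
  have "R (P + Q) = R P + A 0 * Q * transpose_mat (A 0)"
    unfolding R_def using d by (intro eq_matI) (simp_all add: mat_expand)
  then have 1: "out_cov C V ?A ?G (R (P + Q)) N = out_cov C V ?A ?G (R P) N + K * Q * transpose_mat K"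
    using Suc.IH[of ?A ?G "R P" "A 0 * Q * transpose_mat (A 0)"] Suc.prems(1,2) R Q' d
    by (simp add: H_def[symmetric] K_def mat_transpose_mult mat_mult_assoc)
  have "out_map C A (Suc N) * Q * transpose_mat (out_map C A (Suc N))
      = four_block_mat (C * Q * transpose_mat C) (C * Q * transpose_mat K)
          (K * Q * transpose_mat C) (K * Q * transpose_mat K)"
    unfolding out_map.simps H_def[symmetric] K_def[symmetric]
    using C K Suc.prems(4)
    by (simp add: append_rows_mult[of _ r n _ ?m _ n] append_rows_mult_transpose[of _ r n _ ?m _ r _ ?m])
  moreover have "out_cov C V A G (P + Q) (Suc N)
    = four_block_mat (innov_cov C V P + C * Q * transpose_mat C)
        (C * P * transpose_mat K + C * Q * transpose_mat K)
        (K * P * transpose_mat C + K * Q * transpose_mat C)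
        (out_cov C V ?A ?G (R P) N + K * Q * transpose_mat K)"
    unfolding out_cov.simps Let_def R_def[symmetric] H_def[symmetric] K_def[symmetric] 1
    using d by (intro cong_four_block_mat eq_matI) (simp_all add: innov_cov_def mat_expand)
  moreover have "out_cov C V A G P (Suc N)
    = four_block_mat (innov_cov C V P) (C * P * transpose_mat K) (K * P * transpose_mat C)
        (out_cov C V ?A ?G (R P) N)"
    by (simp add: Let_def R_def H_def K_def)
  ultimately show ?case
    using d out_cov_carrier[of ?A ?G "R P" N]
    by (simp only:, subst add_four_block_mat[of _ r r _ ?m _ ?m])
       (auto simp: innov_cov_def intro!: carrier_matI)
qed


section \<open>Elimination of the first output block\<close>

text \<open>\<open>K\<close> is the regression matrix of the later outputs on y_0: by the gain
  identity \<open>K * D\<close> is their covariance with y_0. The covariance of x_1 exceeds the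
  predicted one by A_0 L D L^T A_0^T, and \<open>out_cov_add\<close> carries this excess to the
  outputs as K D K^T.\<close>

lemma out_cov_Suc_ldl:
  fixes N A
  assumes A: "\<And>k. k < Suc N \<Longrightarrow> A k \<in> carrier_mat n n"
    and G: "\<And>k. k < Suc N \<Longrightarrow> G k \<in> carrier_mat n q"
    and P: "pos_semidef n P"
  defines "D \<equiv> innov_cov C V P"
    and "K \<equiv> out_map C (\<lambda>k. A (Suc k)) N * A 0 * gain C V P"
    and "S \<equiv> out_cov C V (\<lambda>k. A (Suc k)) (\<lambda>k. G (Suc k)) (pred_cov A G C V P 1) N"
  shows "out_cov C V A G P (Suc N)
    = four_block_mat D (D * transpose_mat K) (K * D) (S + K * D * transpose_mat K)"
proof -
  define H where "H = out_map C (\<lambda>k. A (Suc k)) N"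
  define L where "L = gain C V P"
  define F where "F = filt_cov C V P"
  let ?E = "L * D * transpose_mat L" and ?m = "Suc N * r"
  have A0: "A 0 \<in> carrier_mat n n" and G0: "G 0 \<in> carrier_mat n q" using A[of 0] G[of 0] by auto
  have H: "H \<in> carrier_mat ?m n" unfolding H_def using A by (intro out_map_carrier) simp
  have L: "L \<in> carrier_mat n r" unfolding L_def by (rule gain_carrier[OF P])
  have D: "D \<in> carrier_mat r r" unfolding D_def by (rule pos_defD(1)[OF innov_cov_pos_def[OF P]])
  note d = dims carrier_matD[OF A0] carrier_matD[OF G0] carrier_matD[OF H] carrier_matD[OF L]
    carrier_matD[OF D] pos_semidefD[OF P]
  note g = gain_mult_innov_cov[OF P, folded L_def D_def]
  have F: "F \<in> carrier_mat n n" using d by (auto simp: F_def filt_cov_def L_def[symmetric] D_def[symmetric])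
  have K: "K = H * A 0 * L" by (simp add: K_def H_def L_def)
  have "A 0 * P * transpose_mat (A 0) + G 0 * transpose_mat (G 0)
    = pred_cov A G C V P 1 + A 0 * ?E * transpose_mat (A 0)"
    using d by (intro eq_matI) (simp_all add: filt_cov_def L_def[symmetric] D_def[symmetric] mat_expand)
  then have "out_cov C V (\<lambda>k. A (Suc k)) (\<lambda>k. G (Suc k))
      (A 0 * P * transpose_mat (A 0) + G 0 * transpose_mat (G 0)) N
    = S + H * (A 0 * ?E * transpose_mat (A 0)) * transpose_mat H"
    unfolding S_def H_def
    by (simp only:, intro out_cov_add[where q = q])
       (use A G A0 G0 F d in \<open>auto simp: F_def[symmetric]\<close>)
  also have "H * (A 0 * ?E * transpose_mat (A 0)) * transpose_mat H = K * D * transpose_mat K"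
    unfolding K using d by (simp add: mat_expand)
  finally have 1: "out_cov C V (\<lambda>k. A (Suc k)) (\<lambda>k. G (Suc k))
      (A 0 * P * transpose_mat (A 0) + G 0 * transpose_mat (G 0)) N = S + K * D * transpose_mat K" .
  have 2: "K * D = H * A 0 * P * transpose_mat C"
    unfolding K using d g(1) by (simp add: mat_mult_assoc)
  have "D * transpose_mat K = D * transpose_mat L * transpose_mat (H * A 0)"
    unfolding K using d by (simp add: mat_expand)
  then have 3: "D * transpose_mat K = C * P * transpose_mat (H * A 0)" unfolding g(2) .
  show ?thesis
    unfolding out_cov.simps Let_def 1 unfolding H_def[symmetric] D_def[symmetric] 2 3 ..
qed

text \<open>Observing y_0 = 0 lowers the mean of the later outputs by K C m, and \<open>g\<close> is
  the resulting conditional mean. The same \<open>K\<close> as in the covariance appears, which is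
  the shape that \<open>block_ldl_solution\<close> expects.\<close>

lemma out_mean_Suc_ldl:
  fixes N A and G :: "nat \<Rightarrow> real mat"
  assumes A: "\<And>k. k < Suc N \<Longrightarrow> A k \<in> carrier_mat n n"
    and B: "\<And>k. k < Suc N \<Longrightarrow> B k \<in> carrier_vec n"
    and P: "pos_semidef n P" and m: "m \<in> carrier_vec n"
  defines "K \<equiv> out_map C (\<lambda>k. A (Suc k)) N * A 0 * gain C V P"
    and "g \<equiv> out_mean C (\<lambda>k. A (Suc k)) (\<lambda>k. B (Suc k)) (pred_mean A B G C V P m 1) N"
  shows "out_mean C A B m (Suc N) = (C *\<^sub>v m) @\<^sub>v (g + K *\<^sub>v (C *\<^sub>v m))"
proof -
  define H where "H = out_map C (\<lambda>k. A (Suc k)) N"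
  define L where "L = gain C V P"
  let ?m = "Suc N * r" and ?e = "A 0 *\<^sub>v (L *\<^sub>v (C *\<^sub>v m))"
  have A0: "A 0 \<in> carrier_mat n n" and B0: "B 0 \<in> carrier_vec n" using A[of 0] B[of 0] by auto
  have H: "H \<in> carrier_mat ?m n" unfolding H_def using A by (intro out_map_carrier) simp
  have L: "L \<in> carrier_mat n r" unfolding L_def by (rule gain_carrier[OF P])
  note d = dims carrier_matD[OF A0] carrier_vecD[OF B0] carrier_matD[OF H] carrier_matD[OF L]
    carrier_vecD[OF m]
  have 1: "pred_mean A B G C V P m 1 = (A 0 * (1\<^sub>m n - L * C)) *\<^sub>v m + B 0"
    using d by (simp add: L_def)
  have "(1\<^sub>m n - L * C) *\<^sub>v m = m - L *\<^sub>v (C *\<^sub>v m)"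
    using d m by (simp add: mat_vec_expand)
  then have "(A 0 * (1\<^sub>m n - L * C)) *\<^sub>v m = A 0 *\<^sub>v m - ?e"
    using d by (simp add: mat_vec_expand)
  then have "A 0 *\<^sub>v m + B 0 = pred_mean A B G C V P m 1 + ?e"
    unfolding 1 using d by (intro eq_vecI) simp_all
  then have "out_mean C (\<lambda>k. A (Suc k)) (\<lambda>k. B (Suc k)) (A 0 *\<^sub>v m + B 0) N = g + H *\<^sub>v ?e"
    unfolding g_def H_def
    by (simp only:, intro out_mean_add) (use A B d 1 in \<open>auto intro: carrier_vecI\<close>)
  also have "H *\<^sub>v ?e = K *\<^sub>v (C *\<^sub>v m)"
    unfolding K_def H_def[symmetric] L_def[symmetric] using d by (simp add: mat_vec_expand)
  finally show ?thesis by simp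
qed

section \<open>Determinant and quadratic form of the stacked covariance\<close>

lemma det_out_cov:
  assumes "\<And>k. k < N \<Longrightarrow> A k \<in> carrier_mat n n" "\<And>k. k < N \<Longrightarrow> G k \<in> carrier_mat n q"
    and "pos_semidef n P"
  shows "det (out_cov C V A G P N) = (\<Prod>k\<le>N. det (innov_cov C V (pred_cov A G C V P k)))"
  using assms
proof (induction N arbitrary: A G P)
  case (Suc N)
  let ?A = "\<lambda>k. A (Suc k)" and ?G = "\<lambda>k. G (Suc k)" and ?P = "pred_cov A G C V P 1"
  have P1: "pos_semidef n ?P"
    using Suc.prems by (intro pred_cov_pos_semidef[of P "Suc N" A G q]) auto
  have "out_map C ?A N * A 0 * gain C V P \<in> carrier_mat (Suc N * r) r"
    using out_map_carrier[of N ?A] Suc.prems(1) gain_carrier[OF Suc.prems(3)]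
    by (auto intro!: mult_carrier_mat[of _ _ n])
  moreover note out_cov_Suc_ldl[of N A G q P]
  ultimately have "det (out_cov C V A G P (Suc N))
    = det (innov_cov C V P) * det (out_cov C V ?A ?G ?P N)"
    using Suc.prems by (simp only:, intro det_block_ldl[of _ r _ "Suc N * r"] out_cov_carrier
        pos_defD(1)[OF innov_cov_pos_def[OF Suc.prems(3)]])
  also have "det (out_cov C V ?A ?G ?P N)
    = (\<Prod>k\<le>N. det (innov_cov C V (pred_cov A G C V P (Suc k))))"
    unfolding pred_cov_shift[of A G C V P] using Suc.prems P1 by (intro Suc.IH) auto
  finally show ?case by (simp only: prod.atMost_Suc_shift pred_cov.simps(1))
qed simp

text \<open>A solution \<open>s\<close> stands in for the inverse of the stacked covariance:
  \<open>block_ldl_solution\<close> returns such a solution \<open>w\<close> for the trailing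
  system, so the induction hypothesis applies directly and no block inverse is formed. Only the
  innovation covariances are inverted.\<close>

lemma out_cov_quadratic_form:
  assumes "\<And>k. k < N \<Longrightarrow> A k \<in> carrier_mat n n" "\<And>k. k < N \<Longrightarrow> B k \<in> carrier_vec n"
    and "\<And>k. k < N \<Longrightarrow> G k \<in> carrier_mat n q"
    and "pos_semidef n P" "m \<in> carrier_vec n" "s \<in> carrier_vec (Suc N * r)"
    and "out_cov C V A G P N *\<^sub>v s = out_mean C A B m N"
  shows "out_mean C A B m N \<bullet> s
    = (\<Sum>k\<le>N. wnorm2 (minv (innov_cov C V (pred_cov A G C V P k))) (C *\<^sub>v pred_mean A B G C V P m k))"
  using assms
proof (induction N arbitrary: A B G P m s)
  case 0
  note S = innov_cov_pos_def[OF 0(4)]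
  have "minv (innov_cov C V P) *\<^sub>v (C *\<^sub>v m) = s"
    using 0 by (intro minv_solve[OF pos_defD(1)[OF S] pos_def_det_nonzero[OF S]]) auto
  then show ?case by (simp add: wnorm2_def)
next
  case (Suc N)
  let ?A = "\<lambda>k. A (Suc k)" and ?B = "\<lambda>k. B (Suc k)" and ?G = "\<lambda>k. G (Suc k)"
    and ?P = "pred_cov A G C V P 1" and ?m = "pred_mean A B G C V P m 1"
  have P1: "pos_semidef n ?P"
    using Suc.prems by (intro pred_cov_pos_semidef[of P "Suc N" A G q]) auto
  have m1: "?m \<in> carrier_vec n" using Suc.prems(2)[of 0] by (intro carrier_vecI) simp
  have K: "out_map C ?A N * A 0 * gain C V P \<in> carrier_mat (Suc N * r) r"
    using out_map_carrier[of N ?A] Suc.prems(1) gain_carrier[OF Suc.prems(4)]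
    by (auto intro!: mult_carrier_mat[of _ _ n])
  note S = innov_cov_pos_def[OF Suc.prems(4)]
  have f: "C *\<^sub>v m \<in> carrier_vec r" using dims by (auto intro: carrier_vecI)
  have s: "s \<in> carrier_vec (r + Suc N * r)" using Suc.prems(6) by simp
  let ?K = "out_map C ?A N * A 0 * gain C V P"
  have mean: "out_mean C A B m (Suc N) = (C *\<^sub>v m) @\<^sub>v (out_mean C ?A ?B ?m N + ?K *\<^sub>v (C *\<^sub>v m))"
    using Suc.prems by (intro out_mean_Suc_ldl)
  have cov: "out_cov C V A G P (Suc N) = four_block_mat (innov_cov C V P)
      (innov_cov C V P * transpose_mat ?K) (?K * innov_cov C V P)
      (out_cov C V ?A ?G ?P N + ?K * innov_cov C V P * transpose_mat ?K)"
    using Suc.prems by (intro out_cov_Suc_ldl)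
  obtain t w where t: "t \<in> carrier_vec r" and w: "w \<in> carrier_vec (Suc N * r)"
    and Dt: "innov_cov C V P *\<^sub>v t = C *\<^sub>v m"
    and Sw: "out_cov C V ?A ?G ?P N *\<^sub>v w = out_mean C ?A ?B ?m N"
    and prod: "out_mean C A B m (Suc N) \<bullet> s = (C *\<^sub>v m) \<bullet> t + out_mean C ?A ?B ?m N \<bullet> w"
    unfolding mean
    by (rule block_ldl_solution[OF pos_defD(1)[OF S] out_cov_carrier K f out_mean_carrier s
          Suc.prems(7)[unfolded mean cov]])
  have "minv (innov_cov C V P) *\<^sub>v (C *\<^sub>v m) = t"
    by (rule minv_solve[OF pos_defD(1)[OF S] pos_def_det_nonzero[OF S] t Dt])
  then have 1: "(C *\<^sub>v m) \<bullet> t = wnorm2 (minv (innov_cov C V P)) (C *\<^sub>v m)"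
    by (simp add: wnorm2_def)
  have "out_mean C ?A ?B ?m N \<bullet> w
    = (\<Sum>k\<le>N. wnorm2 (minv (innov_cov C V (pred_cov A G C V P (Suc k))))
        (C *\<^sub>v pred_mean A B G C V P m (Suc k)))"
    unfolding pred_cov_shift[of A G C V P] pred_mean_shift[of A B G C V P m]
    using Suc.prems P1 m1 w Sw by (intro Suc.IH) auto
  with 1 prod show ?case
    by (simp only: sum.atMost_Suc_shift pred_cov.simps(1) pred_mean.simps(1))
qed

lemma det_innov_cov_nonzero:
  assumes "\<And>k. k < N \<Longrightarrow> A k \<in> carrier_mat n n" "\<And>k. k < N \<Longrightarrow> G k \<in> carrier_mat n q"
    and "pos_semidef n P" "k \<le> N"
  shows "det (innov_cov C V (pred_cov A G C V P k)) \<noteq> 0"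
  using assms by (intro pos_def_det_nonzero[of r] innov_cov_pos_def pred_cov_pos_semidef)

end

section \<open>Stacked form\<close>

lemma dim_block_mat [simp]:
  "dim_row (block_mat p q r c M) = p * r" "dim_col (block_mat p q r c M) = q * c"
  by (simp_all add: block_mat_def)

lemma dim_block_vec [simp]: "dim_vec (block_vec p r b) = p * r"
  by (simp add: block_vec_def)

lemma index_block_mat [simp]:
  "i < p * r \<Longrightarrow> j < q * c \<Longrightarrow> block_mat p q r c M $$ (i, j) = M (i div r) (j div c) $$ (i mod r, j mod c)"
  by (simp add: block_mat_def)

lemma index_block_vec [simp]:
  "i < p * r \<Longrightarrow> block_vec p r b $ i = b (i div r) $ (i mod r)"
  by (simp add: block_vec_def)

lemma div_mod_less:
  assumes "(i::nat) < p * r"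
  shows "i div r < p" "i mod r < r" "0 < r"
  using assms by (auto simp: less_mult_imp_div_less intro!: mod_less_divisor gr0I)

lemma div_mod_minus:
  assumes "\<not> (i::nat) < r" "0 < r"
  shows "i div r = Suc ((i - r) div r)" "i mod r = (i - r) mod r"
  using assms by (simp_all add: le_div_geq le_mod_geq)

lemma block_mat_cong:
  assumes "\<And>k l. k < p \<Longrightarrow> l < q \<Longrightarrow> M k l = M' k l"
  shows "block_mat p q r c M = block_mat p q r c M'"
  using assms by (intro eq_matI) (auto simp: div_mod_less)

lemma block_vec_cong:
  assumes "\<And>k. k < p \<Longrightarrow> b k = b' k"
  shows "block_vec p r b = block_vec p r b'"
  using assms by (intro eq_vecI) (auto simp: div_mod_less)

lemma block_mat_zero: "block_mat p q r c (\<lambda>_ _. 0\<^sub>m r c) = 0\<^sub>m (p * r) (q * c)"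
  by (intro eq_matI) (auto simp: div_mod_less)

lemma block_mat_single: "M 0 0 \<in> carrier_mat r c \<Longrightarrow> block_mat 1 1 r c M = M 0 0"
  by (intro eq_matI) auto

lemma block_mat_Suc_Suc:
  assumes "M 0 0 \<in> carrier_mat r c"
  shows "block_mat (Suc p) (Suc q) r c M
    = four_block_mat (M 0 0) (block_mat 1 q r c (\<lambda>k l. M k (Suc l)))
        (block_mat p 1 r c (\<lambda>k l. M (Suc k) l)) (block_mat p q r c (\<lambda>k l. M (Suc k) (Suc l)))"
    (is "?L = ?R")
proof (rule eq_matI)
  fix i j assume "i < dim_row ?R" "j < dim_col ?R"
  then have i: "i < Suc p * r" and j: "j < Suc q * c" using assms by auto
  note ri = div_mod_less(3)[OF i] and cj = div_mod_less(3)[OF j]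
  show "?L $$ (i, j) = ?R $$ (i, j)"
    using i j ri cj assms
    by (cases "i < r"; cases "j < c") (auto simp: div_mod_minus)
qed (use assms in auto)

lemma block_mat_Suc_rows:
  assumes "M 0 0 \<in> carrier_mat r c"
  shows "block_mat (Suc p) 1 r c M = M 0 0 @\<^sub>r block_mat p 1 r c (\<lambda>k l. M (Suc k) l)" (is "?L = ?R")
proof (rule eq_matI)
  fix i j assume "i < dim_row ?R" "j < dim_col ?R"
  then have i: "i < Suc p * r" and j: "j < 1 * c" using assms by (auto simp: append_rows_def)
  note ri = div_mod_less(3)[OF i]
  show "?L $$ (i, j) = ?R $$ (i, j)"
    using i j ri assms by (cases "i < r") (auto simp: append_rows_def div_mod_minus)
qed (use assms in \<open>auto simp: append_rows_def\<close>)

lemma block_vec_Suc: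
  assumes "b 0 \<in> carrier_vec r"
  shows "block_vec (Suc p) r b = b 0 @\<^sub>v block_vec p r (\<lambda>k. b (Suc k))" (is "?L = ?R")
proof (rule eq_vecI)
  fix i assume "i < dim_vec ?R"
  then have i: "i < Suc p * r" using assms by auto
  show "?L $ i = ?R $ i"
    using i div_mod_less(3)[OF i] assms by (cases "i < r") (auto simp: div_mod_minus)
qed (use assms in auto)

lemma row_block_mat:
  assumes "i < p * r" "M (i div r) 0 \<in> carrier_mat r c"
  shows "row (block_mat p (Suc 0) r c M) i = row (M (i div r) 0) (i mod r)"
  using assms div_mod_less[OF assms(1)] by (intro eq_vecI) auto

lemma block_mat_mult:
  assumes "\<And>k. k < p \<Longrightarrow> M k 0 \<in> carrier_mat r c" "X \<in> carrier_mat c d"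
  shows "block_mat p 1 r c M * X = block_mat p 1 r d (\<lambda>k l. M k l * X)"
proof (rule eq_matI)
  fix i j assume "i < dim_row (block_mat p 1 r d (\<lambda>k l. M k l * X))"
    "j < dim_col (block_mat p 1 r d (\<lambda>k l. M k l * X))"
  then have i: "i < p * r" and j: "j < d" by auto
  note di = div_mod_less[OF i]
  show "(block_mat p 1 r c M * X) $$ (i, j) = block_mat p 1 r d (\<lambda>k l. M k l * X) $$ (i, j)"
    using i j di assms(1)[OF di(1)] assms(2) by (simp add: row_block_mat)
qed (use assms in auto)

lemma block_mat_mult_vec:
  assumes "\<And>k. k < p \<Longrightarrow> M k 0 \<in> carrier_mat r c" "x \<in> carrier_vec c"
  shows "block_mat p 1 r c M *\<^sub>v x = block_vec p r (\<lambda>k. M k 0 *\<^sub>v x)"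
proof (rule eq_vecI)
  fix i assume "i < dim_vec (block_vec p r (\<lambda>k. M k 0 *\<^sub>v x))"
  then have i: "i < p * r" by auto
  note di = div_mod_less[OF i]
  show "(block_mat p 1 r c M *\<^sub>v x) $ i = block_vec p r (\<lambda>k. M k 0 *\<^sub>v x) $ i"
    using i di assms(1)[OF di(1)] by (simp add: row_block_mat)
qed auto

lemma block_vec_add:
  assumes "\<And>k. k < p \<Longrightarrow> b' k \<in> carrier_vec r"
  shows "block_vec p r (\<lambda>k. b k + b' k) = block_vec p r b + block_vec p r b'"
proof (rule eq_vecI)
  fix i assume "i < dim_vec (block_vec p r b + block_vec p r b')"
  then have i: "i < p * r" by auto
  note di = div_mod_less[OF i]
  show "block_vec p r (\<lambda>k. b k + b' k) $ i = (block_vec p r b + block_vec p r b') $ i"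
    using i di assms[OF di(1)] by simp
qed auto

lemma kronecker_one_Suc:
  assumes Q: "Q \<in> carrier_mat r c"
  shows "kronecker (1\<^sub>m (Suc p)) Q
    = four_block_mat Q (0\<^sub>m r (p * c)) (0\<^sub>m (p * r) c) (kronecker (1\<^sub>m p) Q)"
proof -
  have 1: "block_mat 1 p r c (\<lambda>k l. 1\<^sub>m (Suc p) $$ (k, Suc l) \<cdot>\<^sub>m Q) = 0\<^sub>m (1 * r) (p * c)"
    unfolding block_mat_zero[symmetric] using Q by (intro block_mat_cong eq_matI) auto
  have 2: "block_mat p 1 r c (\<lambda>k l. 1\<^sub>m (Suc p) $$ (Suc k, l) \<cdot>\<^sub>m Q) = 0\<^sub>m (p * r) (1 * c)"
    unfolding block_mat_zero[symmetric] using Q by (intro block_mat_cong eq_matI) auto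
  have 3: "block_mat p p r c (\<lambda>k l. 1\<^sub>m (Suc p) $$ (Suc k, Suc l) \<cdot>\<^sub>m Q)
      = block_mat p p r c (\<lambda>k l. 1\<^sub>m p $$ (k, l) \<cdot>\<^sub>m Q)"
    by (intro block_mat_cong) auto
  have 4: "1\<^sub>m (Suc p) $$ (0, 0) \<cdot>\<^sub>m Q = Q" by (intro eq_matI) auto
  have "1\<^sub>m (Suc p) $$ (0, 0) \<cdot>\<^sub>m Q \<in> carrier_mat r c" using Q by simp
  from block_mat_Suc_Suc[where M = "\<lambda>k l. 1\<^sub>m (Suc p) $$ (k, l) \<cdot>\<^sub>m Q", OF this, of p p]
  show ?thesis using Q unfolding kronecker_def 1 2 3 4 by simp
qed

lemma kronecker_one_one: "kronecker (1\<^sub>m (Suc 0)) Q = Q"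
  by (intro eq_matI) (auto simp: kronecker_def)

lemma kronecker_carrier: "Q \<in> carrier_mat r c \<Longrightarrow> kronecker (1\<^sub>m p) Q \<in> carrier_mat (p * r) (p * c)"
  by (auto simp: kronecker_def)

section \<open>Stacked matrices, by recursion on the horizon\<close>

text \<open>\<open>transition\<close> with the system, parameter and input replaced by one sequence
  of matrices; only in this form can the coefficients be shifted in time.\<close>

primrec state_trans :: "nat \<Rightarrow> (nat \<Rightarrow> real mat) \<Rightarrow> nat \<Rightarrow> nat \<Rightarrow> real mat" where
  "state_trans n A 0 j = 1\<^sub>m n"
| "state_trans n A (Suc k) j = (if j \<le> k then A k * state_trans n A k j else 1\<^sub>m n)"

lemma transition_eq_state_trans:
  "transition \<S> \<theta> u k j = state_trans (dim_x \<S>) (\<lambda>k. Amat \<S> \<theta> (u k)) k j"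
  by (induction k) simp_all

lemma state_trans_carrier:
  "(\<And>i. i < k \<Longrightarrow> A i \<in> carrier_mat n n) \<Longrightarrow> state_trans n A k j \<in> carrier_mat n n"
  by (induction k) (auto intro: mult_carrier_mat)

lemma state_trans_Suc_Suc: "state_trans n A (Suc k) (Suc j) = state_trans n (\<lambda>k. A (Suc k)) k j"
  by (induction k) auto

text \<open>The definition adds the newest factor on the left; associativity exposes the oldest one
  on the right, where removal of time 0 needs it.\<close>

lemma state_trans_Suc_0:
  "(\<And>i. i \<le> k \<Longrightarrow> A i \<in> carrier_mat n n)
    \<Longrightarrow> state_trans n A (Suc k) 0 = state_trans n (\<lambda>k. A (Suc k)) k 0 * A 0"
proof (induction k)
  case 0
  then show ?case by simp
next
  case (Suc k)
  have "state_trans n (\<lambda>k. A (Suc k)) k 0 \<in> carrier_mat n n" using Suc.prems by (intro state_trans_carrier) simp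
  moreover have "A (Suc k) \<in> carrier_mat n n" "A 0 \<in> carrier_mat n n" using Suc.prems by auto
  ultimately have "A (Suc k) * (state_trans n (\<lambda>k. A (Suc k)) k 0 * A 0)
      = A (Suc k) * state_trans n (\<lambda>k. A (Suc k)) k 0 * A 0"
    by (intro assoc_mult_mat[symmetric])
  moreover have "state_trans n A (Suc k) 0 = state_trans n (\<lambda>k. A (Suc k)) k 0 * A 0"
    using Suc by simp
  ultimately show ?case by simp
qed

definition stack_A :: "nat \<Rightarrow> (nat \<Rightarrow> real mat) \<Rightarrow> nat \<Rightarrow> real mat" where
  "stack_A n A N = block_mat (Suc N) 1 n n (\<lambda>k _. state_trans n A k 0)"

definition stack_B :: "nat \<Rightarrow> (nat \<Rightarrow> real mat) \<Rightarrow> (nat \<Rightarrow> real vec) \<Rightarrow> nat \<Rightarrow> real vec" where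
  "stack_B n A B N = block_vec (Suc N) n
     (\<lambda>k. finsum_vec TYPE(real) n (\<lambda>j. state_trans n A k (Suc j) *\<^sub>v B j) {0..<k})"

definition stack_G :: "nat \<Rightarrow> nat \<Rightarrow> (nat \<Rightarrow> real mat) \<Rightarrow> (nat \<Rightarrow> real mat) \<Rightarrow> nat \<Rightarrow> real mat" where
  "stack_G n q A G N = block_mat (Suc N) N n q
     (\<lambda>k j. if j < k then state_trans n A k (Suc j) * G j else 0\<^sub>m n q)"

lemma stack_carrier:
  "stack_A n A N \<in> carrier_mat (Suc N * n) n" "stack_B n A B N \<in> carrier_vec (Suc N * n)"
  "stack_G n q A G N \<in> carrier_mat (Suc N * n) (N * q)"
  by (auto simp: stack_A_def stack_B_def stack_G_def intro: carrier_vecI)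

lemma stack_A_Suc:
  assumes "\<And>i. i \<le> N \<Longrightarrow> A i \<in> carrier_mat n n"
  shows "stack_A n A (Suc N) = 1\<^sub>m n @\<^sub>r (stack_A n (\<lambda>k. A (Suc k)) N * A 0)"
proof -
  have "stack_A n A (Suc N) = 1\<^sub>m n @\<^sub>r block_mat (Suc N) 1 n n (\<lambda>k _. state_trans n A (Suc k) 0)"
    unfolding stack_A_def by (subst block_mat_Suc_rows) simp_all
  also have "block_mat (Suc N) 1 n n (\<lambda>k _. state_trans n A (Suc k) 0)
      = block_mat (Suc N) 1 n n (\<lambda>k _. state_trans n (\<lambda>k. A (Suc k)) k 0 * A 0)"
    using assms by (intro block_mat_cong state_trans_Suc_0) auto
  also have "\<dots> = stack_A n (\<lambda>k. A (Suc k)) N * A 0"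
    unfolding stack_A_def using assms
    by (intro block_mat_mult[symmetric] state_trans_carrier) auto
  finally show ?thesis .
qed

text \<open>Row 0 vanishes since no process noise has reached x_0. Column 0 is the response to w_0,
  which acts like an initial state G_0 w_0 at time 1 and is therefore propagated by the shifted
  \<open>stack_A\<close>.\<close>

lemma stack_G_Suc:
  assumes "\<And>i. i \<le> N \<Longrightarrow> A i \<in> carrier_mat n n" "G 0 \<in> carrier_mat n q"
  shows "stack_G n q A G (Suc N)
    = four_block_mat (0\<^sub>m n q) (0\<^sub>m n (N * q)) (stack_A n (\<lambda>k. A (Suc k)) N * G 0)
        (stack_G n q (\<lambda>k. A (Suc k)) (\<lambda>k. G (Suc k)) N)"
proof -
  have 1: "block_mat 1 N n q (\<lambda>k l. if Suc l < k then state_trans n A k (Suc (Suc l)) * G (Suc l) else 0\<^sub>m n q)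
    = 0\<^sub>m (1 * n) (N * q)"
    unfolding block_mat_zero[symmetric] by (intro block_mat_cong) auto
  have 2: "block_mat (Suc N) 1 n q (\<lambda>k l. if l < Suc k then state_trans n A (Suc k) (Suc l) * G l else 0\<^sub>m n q)
    = stack_A n (\<lambda>k. A (Suc k)) N * G 0"
    unfolding stack_A_def using assms
    by (subst block_mat_mult)
       (auto intro!: block_mat_cong state_trans_carrier simp: state_trans_Suc_Suc simp del: state_trans.simps)
  have 3: "block_mat (Suc N) N n q
      (\<lambda>k l. if Suc l < Suc k then state_trans n A (Suc k) (Suc (Suc l)) * G (Suc l) else 0\<^sub>m n q)
    = stack_G n q (\<lambda>k. A (Suc k)) (\<lambda>k. G (Suc k)) N"
    unfolding stack_G_def state_trans_Suc_Suc by simp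
  show ?thesis
    unfolding stack_G_def[of _ _ _ _ "Suc N"]
    by (subst block_mat_Suc_Suc, simp, unfold 1 2 3, simp)
qed

lemma stack_B_Suc:
  assumes A: "\<And>i. i \<le> N \<Longrightarrow> A i \<in> carrier_mat n n" and B: "\<And>i. i \<le> N \<Longrightarrow> B i \<in> carrier_vec n"
  shows "stack_B n A B (Suc N)
    = 0\<^sub>v n @\<^sub>v (stack_A n (\<lambda>k. A (Suc k)) N *\<^sub>v B 0 + stack_B n (\<lambda>k. A (Suc k)) (\<lambda>k. B (Suc k)) N)"
proof -
  let ?A = "\<lambda>k. A (Suc k)"
  let ?f = "\<lambda>k j. state_trans n ?A k (Suc j) *\<^sub>v B (Suc j)"
  have T: "state_trans n ?A k j \<in> carrier_mat n n" if "k < Suc N" for k j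
    using that A by (intro state_trans_carrier) simp
  have f: "?f k j \<in> carrier_vec n" if "k < Suc N" "j < k" for k j
    using T[OF that(1), of "Suc j"] B[of "Suc j"] that by auto
  have F: "finsum_vec TYPE(real) n (?f k) {0..<k} \<in> carrier_vec n" if "k < Suc N" for k
    using f[OF that] by (intro finsum_vec_closed) auto
  \<comment> \<open>The term j = 0 is split off entrywise, where \<open>finsum_vec\<close> becomes
    an ordinary sum of reals and the index shift for sums is available.\<close>
  have step: "finsum_vec TYPE(real) n (\<lambda>j. state_trans n A (Suc k) (Suc j) *\<^sub>v B j) {0..<Suc k}
    = state_trans n ?A k 0 *\<^sub>v B 0 + finsum_vec TYPE(real) n (?f k) {0..<k}" if k: "k < Suc N" for k
  proof (rule eq_vecI)
    have c: "state_trans n ?A k j *\<^sub>v B j \<in> carrier_vec n" if "j \<le> k" for j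
      using T[OF k, of j] B[of j] k that by auto
    have "finsum_vec TYPE(real) n (\<lambda>j. state_trans n ?A k j *\<^sub>v B j) {0..<Suc k} \<in> carrier_vec n"
      using c by (intro finsum_vec_closed) auto
    then show "dim_vec (finsum_vec TYPE(real) n (\<lambda>j. state_trans n A (Suc k) (Suc j) *\<^sub>v B j) {0..<Suc k})
      = dim_vec (state_trans n ?A k 0 *\<^sub>v B 0 + finsum_vec TYPE(real) n (?f k) {0..<k})"
      unfolding state_trans_Suc_Suc using F[OF k] by (simp only: carrier_vecD index_add_vec)
    fix i assume "i < dim_vec (state_trans n ?A k 0 *\<^sub>v B 0 + finsum_vec TYPE(real) n (?f k) {0..<k})"
    then have i: "i < n" using F[OF k] by simp
    have "finsum_vec TYPE(real) n (\<lambda>j. state_trans n ?A k j *\<^sub>v B j) {0..<Suc k} $ i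
      = (\<Sum>j = 0..<Suc k. (state_trans n ?A k j *\<^sub>v B j) $ i)"
      using c i by (intro index_finsum_vec) auto
    also have "\<dots> = (state_trans n ?A k 0 *\<^sub>v B 0) $ i + (\<Sum>j = 0..<k. ?f k j $ i)"
      by (subst sum.atLeast0_lessThan_Suc_shift) simp
    also have "(\<Sum>j = 0..<k. ?f k j $ i) = finsum_vec TYPE(real) n (?f k) {0..<k} $ i"
      using f[OF k] i by (intro index_finsum_vec[symmetric]) auto
    finally show "finsum_vec TYPE(real) n (\<lambda>j. state_trans n A (Suc k) (Suc j) *\<^sub>v B j) {0..<Suc k} $ i
      = (state_trans n ?A k 0 *\<^sub>v B 0 + finsum_vec TYPE(real) n (?f k) {0..<k}) $ i"
      unfolding state_trans_Suc_Suc using F[OF k] i by simp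
  qed
  have "stack_B n A B (Suc N) = 0\<^sub>v n @\<^sub>v block_vec (Suc N) n
      (\<lambda>k. finsum_vec TYPE(real) n (\<lambda>j. state_trans n A (Suc k) (Suc j) *\<^sub>v B j) {0..<Suc k})"
    unfolding stack_B_def by (subst block_vec_Suc) (simp_all add: finsum_vec_empty)
  also have "block_vec (Suc N) n
      (\<lambda>k. finsum_vec TYPE(real) n (\<lambda>j. state_trans n A (Suc k) (Suc j) *\<^sub>v B j) {0..<Suc k})
    = block_vec (Suc N) n (\<lambda>k. state_trans n ?A k 0 *\<^sub>v B 0 + finsum_vec TYPE(real) n (?f k) {0..<k})"
    using step by (intro block_vec_cong)
  also have "\<dots> = stack_A n ?A N *\<^sub>v B 0 + stack_B n ?A (\<lambda>k. B (Suc k)) N"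
  proof -
    have "stack_A n ?A N *\<^sub>v B 0 = block_vec (Suc N) n (\<lambda>k. state_trans n ?A k 0 *\<^sub>v B 0)"
      unfolding stack_A_def using T B by (intro block_mat_mult_vec) auto
    then show ?thesis
      unfolding stack_B_def using F by (simp only:, intro block_vec_add)
  qed
  finally show ?thesis .
qed

lemma stack_0:
  "stack_A n A 0 = 1\<^sub>m n" "stack_B n A B 0 = 0\<^sub>v n" "stack_G n q A G 0 = 0\<^sub>m n 0"
proof -
  show "stack_A n A 0 = 1\<^sub>m n" unfolding stack_A_def using block_mat_single[of "\<lambda>k _. state_trans n A k 0"] by simp
  show "stack_B n A B 0 = 0\<^sub>v n" unfolding stack_B_def by (intro eq_vecI) (auto simp: finsum_vec_empty)
  show "stack_G n q A G 0 = 0\<^sub>m n 0" by (intro eq_matI) (auto simp: stack_G_def)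
qed

section \<open>Covariance of the stacked state\<close>

lemma block_diag_mult_append_rows:
  fixes P :: "real mat"
  assumes "P \<in> carrier_mat p p'" "Q \<in> carrier_mat q q'" "X \<in> carrier_mat p' n" "Y \<in> carrier_mat q' n"
  shows "four_block_mat P (0\<^sub>m p q') (0\<^sub>m q p') Q * (X @\<^sub>r Y) = P * X @\<^sub>r Q * Y"
  unfolding append_rows_def
  by (subst mult_four_block_mat[of _ p p' _ q' _ q _ _ n _ 0]) (use assms in auto)

text \<open>Serves for conjugation by \<open>kronecker (1\<^sub>m (Suc p)) C\<close>, which
  \<open>kronecker_one_Suc\<close> brings into this shape; \<open>C\<close> is rectangular, hence
  the four sizes.\<close>

lemma block_diag_congruence:
  fixes P :: "real mat"
  assumes P: "P \<in> carrier_mat p p'" and Q: "Q \<in> carrier_mat q q'"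
    and M: "M1 \<in> carrier_mat p' p'" "M2 \<in> carrier_mat p' q'" "M3 \<in> carrier_mat q' p'" "M4 \<in> carrier_mat q' q'"
  shows "four_block_mat P (0\<^sub>m p q') (0\<^sub>m q p') Q * four_block_mat M1 M2 M3 M4
      * transpose_mat (four_block_mat P (0\<^sub>m p q') (0\<^sub>m q p') Q)
    = four_block_mat (P * M1 * transpose_mat P) (P * M2 * transpose_mat Q)
        (Q * M3 * transpose_mat P) (Q * M4 * transpose_mat Q)"
proof -
  have 1: "four_block_mat P (0\<^sub>m p q') (0\<^sub>m q p') Q * four_block_mat M1 M2 M3 M4
    = four_block_mat (P * M1) (P * M2) (Q * M3) (Q * M4)"
    by (subst mult_four_block_mat[of _ p p' _ q' _ q _ _ p' _ q']) (use assms in auto)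
  have 2: "transpose_mat (four_block_mat P (0\<^sub>m p q') (0\<^sub>m q p') Q)
    = four_block_mat (transpose_mat P) (0\<^sub>m p' q) (0\<^sub>m q' p) (transpose_mat Q)"
    by (subst transpose_four_block_mat[of _ p p' _ q' _ q]) (use assms in auto)
  show ?thesis unfolding 1 2
    by (subst mult_four_block_mat[of _ p p' _ q' _ q _ _ p _ q]) (use assms in auto)
qed

text \<open>\<open>R\<close> is the covariance of x_1. The initial state and w_0 both act on later
  states through x_1, so their contributions to the last block combine into A' R A'^T, while w_0
  contributes nothing to the blocks involving x_0.\<close>

lemma stack_cov_Suc:
  assumes A: "\<And>i. i < Suc N \<Longrightarrow> A i \<in> carrier_mat n n" and G: "\<And>i. i < Suc N \<Longrightarrow> G i \<in> carrier_mat n q"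
    and P: "P \<in> carrier_mat n n"
  defines "A' \<equiv> stack_A n (\<lambda>k. A (Suc k)) N" and "G' \<equiv> stack_G n q (\<lambda>k. A (Suc k)) (\<lambda>k. G (Suc k)) N"
    and "R \<equiv> A 0 * P * transpose_mat (A 0) + G 0 * transpose_mat (G 0)"
  shows "stack_A n A (Suc N) * P * transpose_mat (stack_A n A (Suc N))
      + stack_G n q A G (Suc N) * transpose_mat (stack_G n q A G (Suc N))
    = four_block_mat P (P * transpose_mat (A' * A 0)) (A' * A 0 * P)
        (A' * R * transpose_mat A' + G' * transpose_mat G')"
proof -
  let ?m = "Suc N * n" and ?X = "A' * A 0"
  have A0: "A 0 \<in> carrier_mat n n" and G0: "G 0 \<in> carrier_mat n q" using A[of 0] G[of 0] by auto
  have A': "A' \<in> carrier_mat ?m n" and G': "G' \<in> carrier_mat ?m (N * q)"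
    unfolding A'_def G'_def by (rule stack_carrier)+
  have X: "?X \<in> carrier_mat ?m n" using A' A0 by simp
  note d = carrier_matD[OF A0] carrier_matD[OF G0] carrier_matD[OF A'] carrier_matD[OF G']
    carrier_matD[OF P] carrier_matD[OF X]
  have a: "stack_A n A (Suc N) = 1\<^sub>m n @\<^sub>r ?X"
    unfolding A'_def using A by (intro stack_A_Suc) auto
  have g: "stack_G n q A G (Suc N) = four_block_mat (0\<^sub>m n q) (0\<^sub>m n (N * q)) (A' * G 0) G'"
    unfolding A'_def G'_def using A G by (intro stack_G_Suc) auto
  have "(1\<^sub>m n @\<^sub>r ?X) * P = P @\<^sub>r ?X * P"
    using append_rows_mult[of "1\<^sub>m n" n n ?X ?m P n] X P by simp
  then have 1: "stack_A n A (Suc N) * P * transpose_mat (stack_A n A (Suc N))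
    = four_block_mat P (P * transpose_mat ?X) (?X * P) (?X * P * transpose_mat ?X)"
    unfolding a using append_rows_mult_transpose[of P n n "?X * P" ?m "1\<^sub>m n" n ?X ?m] X P by simp
  have gt: "transpose_mat (four_block_mat (0\<^sub>m n q) (0\<^sub>m n (N * q)) (A' * G 0) G')
    = four_block_mat (0\<^sub>m q n) (transpose_mat (A' * G 0)) (0\<^sub>m (N * q) n) (transpose_mat G')"
    by (subst transpose_four_block_mat[of _ n q _ "N * q" _ ?m]) (use A' G' G0 in auto)
  have 2: "stack_G n q A G (Suc N) * transpose_mat (stack_G n q A G (Suc N))
    = four_block_mat (0\<^sub>m n n) (0\<^sub>m n ?m) (0\<^sub>m ?m n)
        (A' * G 0 * transpose_mat (A' * G 0) + G' * transpose_mat G')"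
    unfolding g gt
    by (subst mult_four_block_mat[of _ n q _ "N * q" _ ?m _ _ n _ ?m])
       (use d in \<open>auto intro!: carrier_matI cong_four_block_mat simp: right_mult_zero_mat'\<close>)
  have 3: "?X * P * transpose_mat ?X + (A' * G 0 * transpose_mat (A' * G 0) + G' * transpose_mat G')
    = A' * R * transpose_mat A' + G' * transpose_mat G'"
    unfolding R_def using d by (intro eq_matI) (simp_all add: mat_expand)
  \<comment> \<open>With \<open>mult_Suc\<close> active, \<open>simp\<close> would rewrite the
    dimension \<open>Suc N * n\<close> and it would no longer match the carrier facts.\<close>
  have "P + 0\<^sub>m n n = P" "P * transpose_mat ?X + 0\<^sub>m n ?m = P * transpose_mat ?X"
    "?X * P + 0\<^sub>m ?m n = ?X * P"
    using d by (auto intro!: right_add_zero_mat carrier_matI simp del: mult_Suc)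
  then show ?thesis
    unfolding 1 2 3[symmetric] using d
    by (subst add_four_block_mat[of _ n n _ ?m _ ?m]) (auto intro!: carrier_matI)
qed

section \<open>Agreement of the recursive outputs with the stacked form\<close>

context observation
begin

lemma out_map_eq_stack:
  assumes "\<And>k. k < N \<Longrightarrow> A k \<in> carrier_mat n n"
  shows "out_map C A N = kronecker (1\<^sub>m (Suc N)) C * stack_A n A N"
  using assms
proof (induction N arbitrary: A)
  case 0
  then show ?case using dims by (simp add: stack_0 kronecker_one_one)
next
  case (Suc N)
  let ?A = "\<lambda>k. A (Suc k)" and ?m = "Suc N * n" and ?r = "Suc N * r"
  have A0: "A 0 \<in> carrier_mat n n" using Suc.prems[of 0] by simp
  have K: "kronecker (1\<^sub>m (Suc N)) C \<in> carrier_mat ?r ?m" by (rule kronecker_carrier[OF C])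
  have S: "stack_A n ?A N \<in> carrier_mat ?m n" by (rule stack_carrier)
  have "kronecker (1\<^sub>m (Suc (Suc N))) C * stack_A n A (Suc N)
    = four_block_mat C (0\<^sub>m r ?m) (0\<^sub>m ?r n) (kronecker (1\<^sub>m (Suc N)) C)
        * (1\<^sub>m n @\<^sub>r (stack_A n ?A N * A 0))"
    using Suc.prems by (subst stack_A_Suc, simp, subst kronecker_one_Suc[OF C], simp)
  also have "\<dots> = C * 1\<^sub>m n @\<^sub>r kronecker (1\<^sub>m (Suc N)) C * (stack_A n ?A N * A 0)"
    using C K S A0 by (intro block_diag_mult_append_rows) auto
  also have "kronecker (1\<^sub>m (Suc N)) C * (stack_A n ?A N * A 0) = out_map C ?A N * A 0"
    using Suc.IH[of ?A] Suc.prems K S A0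
    by (subst mat_mult_assoc[symmetric]) (auto simp del: mult_Suc)
  finally show ?case using dims by simp
qed

lemma out_mean_eq_stack:
  assumes "\<And>k. k < N \<Longrightarrow> A k \<in> carrier_mat n n" "\<And>k. k < N \<Longrightarrow> B k \<in> carrier_vec n"
    and "m \<in> carrier_vec n"
  shows "out_mean C A B m N
    = (kronecker (1\<^sub>m (Suc N)) C * stack_A n A N) *\<^sub>v m + kronecker (1\<^sub>m (Suc N)) C *\<^sub>v stack_B n A B N"
  using assms
proof (induction N arbitrary: A B m)
  case 0
  have "C *\<^sub>v 0\<^sub>v n = 0\<^sub>v r" using dims by (intro eq_vecI) (auto simp: scalar_prod_def)
  moreover have "C *\<^sub>v m \<in> carrier_vec r" using dims by (intro carrier_vecI) simp
  ultimately show ?case using dims by (simp add: stack_0 kronecker_one_one)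
next
  case (Suc N)
  let ?A = "\<lambda>k. A (Suc k)" and ?B = "\<lambda>k. B (Suc k)" and ?m = "Suc N * n" and ?r = "Suc N * r"
  let ?K = "kronecker (1\<^sub>m (Suc N)) C" and ?SA = "stack_A n (\<lambda>k. A (Suc k)) N"
    and ?SB = "stack_B n (\<lambda>k. A (Suc k)) (\<lambda>k. B (Suc k)) N"
  have A0: "A 0 \<in> carrier_mat n n" and B0: "B 0 \<in> carrier_vec n" using Suc.prems(1,2)[of 0] by auto
  have K: "?K \<in> carrier_mat ?r ?m" by (rule kronecker_carrier[OF C])
  have SA: "?SA \<in> carrier_mat ?m n" and SB: "?SB \<in> carrier_vec ?m" by (rule stack_carrier)+
  have H: "out_map C ?A N \<in> carrier_mat ?r n" using Suc.prems(1) by (intro out_map_carrier) simp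
  note d = dims carrier_matD[OF A0] carrier_vecD[OF B0] carrier_matD[OF K] carrier_matD[OF SA]
    carrier_vecD[OF SB] carrier_vecD[OF Suc.prems(3)] carrier_matD[OF H]
  have IH: "out_mean C ?A ?B (A 0 *\<^sub>v m + B 0) N = (?K * ?SA) *\<^sub>v (A 0 *\<^sub>v m + B 0) + ?K *\<^sub>v ?SB"
    using Suc.prems A0 B0 by (intro Suc.IH) (auto intro!: carrier_vecI)
  have hom: "out_map C ?A N = ?K * ?SA" using Suc.prems by (intro out_map_eq_stack) simp
  have "out_map C A (Suc N) *\<^sub>v m = (C *\<^sub>v m) @\<^sub>v ((?K * ?SA * A 0) *\<^sub>v m)"
    using C A0 H Suc.prems(3) unfolding out_map.simps hom
    by (intro mat_mult_append[of _ r n _ ?r]) auto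
  moreover have "kronecker (1\<^sub>m (Suc (Suc N))) C *\<^sub>v stack_B n A B (Suc N)
      = (C *\<^sub>v 0\<^sub>v n + 0\<^sub>m r ?m *\<^sub>v (?SA *\<^sub>v B 0 + ?SB))
        @\<^sub>v (0\<^sub>m ?r n *\<^sub>v 0\<^sub>v n + ?K *\<^sub>v (?SA *\<^sub>v B 0 + ?SB))"
    using Suc.prems C K SA SB B0
    by (subst stack_B_Suc, simp, simp, subst kronecker_one_Suc[OF C],
        intro four_block_mat_mult_vec[of _ r n _ ?m _ ?r]) auto
  moreover have "C *\<^sub>v 0\<^sub>v n + 0\<^sub>m r ?m *\<^sub>v (?SA *\<^sub>v B 0 + ?SB) = 0\<^sub>v r"
    using d by (intro eq_vecI) (auto simp: scalar_prod_def)
  moreover have "0\<^sub>m ?r n *\<^sub>v 0\<^sub>v n + ?K *\<^sub>v (?SA *\<^sub>v B 0 + ?SB) = ?K *\<^sub>v (?SA *\<^sub>v B 0 + ?SB)"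
    using d by (intro eq_vecI) (simp_all del: mult_Suc)
  moreover have "((C *\<^sub>v m) @\<^sub>v ((?K * ?SA * A 0) *\<^sub>v m)) + (0\<^sub>v r @\<^sub>v (?K *\<^sub>v (?SA *\<^sub>v B 0 + ?SB)))
    = (C *\<^sub>v m) @\<^sub>v ((?K * ?SA * A 0) *\<^sub>v m + ?K *\<^sub>v (?SA *\<^sub>v B 0 + ?SB))"
    using d by (intro eq_vecI) (auto simp del: mult_Suc)
  moreover have "(?K * ?SA * A 0) *\<^sub>v m + ?K *\<^sub>v (?SA *\<^sub>v B 0 + ?SB)
    = (?K * ?SA) *\<^sub>v (A 0 *\<^sub>v m + B 0) + ?K *\<^sub>v ?SB"
    using d by (intro eq_vecI) (simp_all add: mat_vec_expand mat_mult_assoc del: mult_Suc)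
  moreover have "out_map C A (Suc N) = kronecker (1\<^sub>m (Suc (Suc N))) C * stack_A n A (Suc N)"
    using Suc.prems(1) by (rule out_map_eq_stack)
  ultimately show ?case by (simp only: out_mean.simps IH)
qed

lemma out_cov_eq_stack:
  assumes "\<And>k. k < N \<Longrightarrow> A k \<in> carrier_mat n n" "\<And>k. k < N \<Longrightarrow> G k \<in> carrier_mat n q"
    and "P \<in> carrier_mat n n"
  shows "out_cov C V A G P N
    = kronecker (1\<^sub>m (Suc N)) C
        * (stack_A n A N * P * transpose_mat (stack_A n A N)
           + stack_G n q A G N * transpose_mat (stack_G n q A G N))
        * transpose_mat (kronecker (1\<^sub>m (Suc N)) C)
      + kronecker (1\<^sub>m (Suc N)) V"
  using assms
proof (induction N arbitrary: A G P)
  case 0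
  \<comment> \<open>At horizon 0 there is no process noise: \<open>stack_G\<close> has no columns,
    and its Gram matrix consists of empty sums.\<close>
  have "(0\<^sub>m n 0 :: real mat) * 0\<^sub>m 0 n = 0\<^sub>m n n" by (intro eq_matI) (auto simp: scalar_prod_def)
  then show ?case
    using 0 dims by (intro eq_matI) (simp_all add: stack_0 kronecker_one_one innov_cov_def)
next
  case (Suc N)
  let ?A = "\<lambda>k. A (Suc k)" and ?G = "\<lambda>k. G (Suc k)" and ?m = "Suc N * n" and ?r = "Suc N * r"
  define K where "K = kronecker (1\<^sub>m (Suc N)) C"
  define W where "W = kronecker (1\<^sub>m (Suc N)) V"
  define SA where "SA = stack_A n ?A N"
  define SG where "SG = stack_G n q ?A ?G N"
  define R where "R = A 0 * P * transpose_mat (A 0) + G 0 * transpose_mat (G 0)"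
  have A0: "A 0 \<in> carrier_mat n n" and G0: "G 0 \<in> carrier_mat n q" using Suc.prems(1,2)[of 0] by auto
  have V': "V \<in> carrier_mat r r" using dims by auto
  have K: "K \<in> carrier_mat ?r ?m" unfolding K_def by (rule kronecker_carrier[OF C])
  have W: "W \<in> carrier_mat ?r ?r" unfolding W_def by (rule kronecker_carrier[OF V'])
  have SA: "SA \<in> carrier_mat ?m n" and SG: "SG \<in> carrier_mat ?m (N * q)"
    unfolding SA_def SG_def by (rule stack_carrier)+
  note d = dims carrier_matD[OF A0] carrier_matD[OF G0] carrier_matD[OF K] carrier_matD[OF SA]
    carrier_matD[OF SG] carrier_matD[OF Suc.prems(3)] carrier_matD[OF W]
  let ?Q = "SA * R * transpose_mat SA + SG * transpose_mat SG"
  have R: "R \<in> carrier_mat n n" using d by (auto simp: R_def)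
  have IH: "out_cov C V ?A ?G R N = K * ?Q * transpose_mat K + W"
    unfolding K_def W_def SA_def SG_def using Suc.prems R by (intro Suc.IH) auto
  have hom: "out_map C ?A N = K * SA"
    unfolding K_def SA_def using Suc.prems by (intro out_map_eq_stack) simp
  have cov: "stack_A n A (Suc N) * P * transpose_mat (stack_A n A (Suc N))
      + stack_G n q A G (Suc N) * transpose_mat (stack_G n q A G (Suc N))
    = four_block_mat P (P * transpose_mat (SA * A 0)) (SA * A 0 * P) ?Q"
    unfolding SA_def SG_def R_def using Suc.prems by (intro stack_cov_Suc)
  have "kronecker (1\<^sub>m (Suc (Suc N))) C
      * (stack_A n A (Suc N) * P * transpose_mat (stack_A n A (Suc N))
         + stack_G n q A G (Suc N) * transpose_mat (stack_G n q A G (Suc N)))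
      * transpose_mat (kronecker (1\<^sub>m (Suc (Suc N))) C)
    = four_block_mat (C * P * transpose_mat C) (C * (P * transpose_mat (SA * A 0)) * transpose_mat K)
        (K * (SA * A 0 * P) * transpose_mat C) (K * ?Q * transpose_mat K)"
    unfolding cov kronecker_one_Suc[OF C, of "Suc N", folded K_def]
    using C K Suc.prems(3) d R
    by (intro block_diag_congruence) (auto simp del: mult_Suc intro!: carrier_matI)
  moreover have "kronecker (1\<^sub>m (Suc (Suc N))) V = four_block_mat V (0\<^sub>m r ?r) (0\<^sub>m ?r r) W"
    unfolding W_def by (rule kronecker_one_Suc[OF V'])
  moreover have "four_block_mat (C * P * transpose_mat C) (C * (P * transpose_mat (SA * A 0)) * transpose_mat K)
        (K * (SA * A 0 * P) * transpose_mat C) (K * ?Q * transpose_mat K)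
      + four_block_mat V (0\<^sub>m r ?r) (0\<^sub>m ?r r) W
    = four_block_mat (C * P * transpose_mat C + V)
        (C * (P * transpose_mat (SA * A 0)) * transpose_mat K + 0\<^sub>m r ?r)
        (K * (SA * A 0 * P) * transpose_mat C + 0\<^sub>m ?r r) (K * ?Q * transpose_mat K + W)"
    using d by (intro add_four_block_mat[of _ r r _ ?r _ ?r]) (auto intro!: carrier_matI simp del: mult_Suc)
  moreover have "C * P * transpose_mat C + V = innov_cov C V P"
    unfolding innov_cov_def using d by (intro comm_add_mat) (auto intro!: carrier_matI)
  moreover have "C * (P * transpose_mat (SA * A 0)) * transpose_mat K + 0\<^sub>m r ?r
      = C * P * transpose_mat (K * SA * A 0)"
    using d by (intro eq_matI) (simp_all add: mat_expand del: mult_Suc)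
  moreover have "K * (SA * A 0 * P) * transpose_mat C + 0\<^sub>m ?r r = K * SA * A 0 * P * transpose_mat C"
    using d by (intro eq_matI) (simp_all add: mat_expand del: mult_Suc)
  ultimately show ?case
    by (simp only: out_cov.simps Let_def R_def[symmetric] IH hom)
qed

end

section \<open>The difference of two outputs\<close>

lemma block_diag_carrier:
  "P \<in> carrier_mat p p' \<Longrightarrow> Q \<in> carrier_mat q q' \<Longrightarrow> block_diag P Q \<in> carrier_mat (p + q) (p' + q')"
  by (auto simp: block_diag_def)

lemma block_diag_mult:
  assumes "P \<in> carrier_mat p p'" "Q \<in> carrier_mat q q'" "P' \<in> carrier_mat p' p''" "Q' \<in> carrier_mat q' q''"
  shows "block_diag P Q * block_diag P' Q' = block_diag (P * P') (Q * Q')"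
  unfolding block_diag_def
  by (subst mult_four_block_mat[of _ p p' _ q' _ q _ _ p'' _ q'']) (use assms in auto)

lemma transpose_block_diag:
  assumes "P \<in> carrier_mat p p'" "Q \<in> carrier_mat q q'"
  shows "transpose_mat (block_diag P Q) = block_diag (transpose_mat P) (transpose_mat Q)"
  unfolding block_diag_def
  by (subst transpose_four_block_mat[of _ p p' _ q' _ q]) (use assms in auto)

lemma block_diag_add:
  assumes "P \<in> carrier_mat p p'" "Q \<in> carrier_mat q q'" "P' \<in> carrier_mat p p'" "Q' \<in> carrier_mat q q'"
  shows "block_diag P Q + block_diag P' Q' = block_diag (P + P') (Q + Q')"
  unfolding block_diag_def
  by (subst add_four_block_mat[of _ p p' _ q' _ q]) (use assms in auto)

lemma block_diag_mult_vec:
  assumes "P \<in> carrier_mat p p" "Q \<in> carrier_mat q q" "x \<in> carrier_vec p" "y \<in> carrier_vec q"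
  shows "block_diag P Q *\<^sub>v (x @\<^sub>v y) = (P *\<^sub>v x) @\<^sub>v (Q *\<^sub>v y)"
  unfolding block_diag_def using mult_mat_vec_split[OF assms] assms by simp

lemma pos_semidef_block_diag:
  assumes P: "pos_semidef p P" and Q: "pos_semidef q Q"
  shows "pos_semidef (p + q) (block_diag P Q)"
proof -
  note c = pos_semidefD(1)[OF P] pos_semidefD(1)[OF Q]
  have "0 \<le> wnorm2 (block_diag P Q) (x @\<^sub>v y)" if "x \<in> carrier_vec p" "y \<in> carrier_vec q" for x y
  proof -
    have "wnorm2 (block_diag P Q) (x @\<^sub>v y) = wnorm2 P x + wnorm2 Q y"
      unfolding wnorm2_def block_diag_mult_vec[OF c that]
      using c that by (intro scalar_prod_append[of _ p _ q]) auto
    then show ?thesis using P Q that by (simp add: pos_semidef_def)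
  qed
  then show ?thesis
    using block_diag_carrier[OF c] transpose_block_diag[OF c] pos_semidefD(2)[OF P] pos_semidefD(2)[OF Q]
    by (simp add: pos_semidef_def all_vec_append)
qed

text \<open>For \<open>H = K = C\<close> this is \<open>tildeC\<close>. Two arguments are kept
  because the observability matrices of the two parameters differ.\<close>

definition diff_mat :: "real mat \<Rightarrow> real mat \<Rightarrow> real mat" where
  "diff_mat H K = (1 / sqrt 2) \<cdot>\<^sub>m append_cols H (- K)"

lemma index_diff_mat:
  assumes "H \<in> carrier_mat p n" "K \<in> carrier_mat p n'"
  shows "dim_row (diff_mat H K) = p" "dim_col (diff_mat H K) = n + n'"
    and "i < p \<Longrightarrow> j < n + n' \<Longrightarrow>
      diff_mat H K $$ (i, j) = (if j < n then H $$ (i, j) / sqrt 2 else - (K $$ (i, j - n)) / sqrt 2)"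
  using assms by (auto simp: diff_mat_def append_cols_def)

lemma diff_mat_carrier:
  "H \<in> carrier_mat p n \<Longrightarrow> K \<in> carrier_mat p n' \<Longrightarrow> diff_mat H K \<in> carrier_mat p (n + n')"
  using index_diff_mat by (metis carrier_matI)

lemma row_diff_mat:
  assumes "H \<in> carrier_mat p n" "K \<in> carrier_mat p n'" "i < p"
  shows "row (diff_mat H K) i = ((1 / sqrt 2) \<cdot>\<^sub>v row H i) @\<^sub>v ((- 1 / sqrt 2) \<cdot>\<^sub>v row K i)"
  using assms index_diff_mat[OF assms(1,2)]
  by (intro eq_vecI) auto

lemma diff_mat_mult_vec:
  assumes H: "H \<in> carrier_mat p n" and K: "K \<in> carrier_mat p n'"
    and x: "x \<in> carrier_vec n" and y: "y \<in> carrier_vec n'"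
  shows "diff_mat H K *\<^sub>v (x @\<^sub>v y) = (1 / sqrt 2) \<cdot>\<^sub>v (H *\<^sub>v x - K *\<^sub>v y)"
proof (rule eq_vecI)
  fix i assume "i < dim_vec ((1 / sqrt 2) \<cdot>\<^sub>v (H *\<^sub>v x - K *\<^sub>v y))"
  then have i: "i < p" using K by simp
  have rH: "row H i \<in> carrier_vec n" and rK: "row K i \<in> carrier_vec n'" using H K i by auto
  have "row (diff_mat H K) i \<bullet> (x @\<^sub>v y)
    = ((1 / sqrt 2) \<cdot>\<^sub>v row H i) \<bullet> x + ((- 1 / sqrt 2) \<cdot>\<^sub>v row K i) \<bullet> y"
    unfolding row_diff_mat[OF H K i] using rH rK x y by (intro scalar_prod_append[of _ n _ n']) auto
  also have "\<dots> = (1 / sqrt 2) * (row H i \<bullet> x - row K i \<bullet> y)"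
    using rH rK x y by (simp add: field_simps)
  finally show "(diff_mat H K *\<^sub>v (x @\<^sub>v y)) $ i = ((1 / sqrt 2) \<cdot>\<^sub>v (H *\<^sub>v x - K *\<^sub>v y)) $ i"
    using i H K index_diff_mat(1)[OF H K] by simp
qed (use K index_diff_mat(1)[OF H K] in simp)

lemma diff_mat_mult_block_diag:
  assumes "H \<in> carrier_mat p n" "K \<in> carrier_mat p n'" "P \<in> carrier_mat n m" "Q \<in> carrier_mat n' m'"
  shows "diff_mat H K * block_diag P Q = diff_mat (H * P) (K * Q)"
proof -
  have "append_cols H (- K) * block_diag P Q = append_cols (H * P) (- (K * Q))"
    unfolding append_cols_def block_diag_def
    by (subst mult_four_block_mat[of _ p n _ n' _ 0 _ _ m _ m']) (use assms in auto)
  moreover have "append_cols H (- K) \<in> carrier_mat p (n + n')"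
    using assms by (auto simp: append_cols_def)
  ultimately show ?thesis
    unfolding diff_mat_def using block_diag_carrier[OF assms(3,4)]
    by (subst mult_smult_assoc_mat) auto
qed

text \<open>The signs cancel in pairs and 1/sqrt 2 is squared. This turns the covariance of a scaled
  difference of uncorrelated outputs into an average.\<close>

lemma diff_mat_mult_transpose:
  assumes H: "H \<in> carrier_mat p n" and K: "K \<in> carrier_mat p n'"
    and H': "H' \<in> carrier_mat p' n" and K': "K' \<in> carrier_mat p' n'"
  shows "diff_mat H K * transpose_mat (diff_mat H' K')
    = (1 / 2) \<cdot>\<^sub>m (H * transpose_mat H' + K * transpose_mat K')"
proof (rule eq_matI)
  fix i j assume "i < dim_row ((1 / 2) \<cdot>\<^sub>m (H * transpose_mat H' + K * transpose_mat K'))"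
    "j < dim_col ((1 / 2) \<cdot>\<^sub>m (H * transpose_mat H' + K * transpose_mat K'))"
  then have i: "i < p" and j: "j < p'" using K K' by auto
  have r: "row H i \<in> carrier_vec n" "row K i \<in> carrier_vec n'" "row H' j \<in> carrier_vec n" "row K' j \<in> carrier_vec n'"
    using assms i j by auto
  have "row (diff_mat H K) i \<bullet> row (diff_mat H' K') j
    = ((1 / sqrt 2) \<cdot>\<^sub>v row H i) \<bullet> ((1 / sqrt 2) \<cdot>\<^sub>v row H' j)
      + ((- 1 / sqrt 2) \<cdot>\<^sub>v row K i) \<bullet> ((- 1 / sqrt 2) \<cdot>\<^sub>v row K' j)"
    unfolding row_diff_mat[OF H K i] row_diff_mat[OF H' K' j]
    using r by (intro scalar_prod_append[of _ n _ n']) auto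
  also have "\<dots> = (1 / 2) * (row H i \<bullet> row H' j + row K i \<bullet> row K' j)"
    using r by (simp add: field_simps)
  finally show "(diff_mat H K * transpose_mat (diff_mat H' K')) $$ (i, j)
      = ((1 / 2) \<cdot>\<^sub>m (H * transpose_mat H' + K * transpose_mat K')) $$ (i, j)"
    using i j H K H' K' index_diff_mat(1)[OF H K] index_diff_mat(1)[OF H' K'] by simp
qed (use K K' index_diff_mat(1)[OF H K] index_diff_mat(1)[OF H' K'] in simp_all)

lemma diff_mat_append_rows:
  assumes "H \<in> carrier_mat p n" "K \<in> carrier_mat p n'" "H' \<in> carrier_mat p' n" "K' \<in> carrier_mat p' n'"
  shows "diff_mat H K @\<^sub>r diff_mat H' K' = diff_mat (H @\<^sub>r H') (K @\<^sub>r K')"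
proof -
  have c: "H @\<^sub>r H' \<in> carrier_mat (p + p') n" "K @\<^sub>r K' \<in> carrier_mat (p + p') n'" using assms by auto
  note ix = index_diff_mat[OF assms(1,2)] index_diff_mat[OF assms(3,4)] index_diff_mat[OF c]
  have rows: "(X @\<^sub>r Y) $$ (i, j) = (if i < p then X $$ (i, j) else Y $$ (i - p, j))"
    if "X \<in> carrier_mat p m" "Y \<in> carrier_mat p' m" "i < p + p'" "j < m" for X Y :: "real mat" and m i j
    using that by (auto simp: append_rows_def)
  have c': "diff_mat H K \<in> carrier_mat p (n + n')" "diff_mat H' K' \<in> carrier_mat p' (n + n')"
    using assms by (auto intro: diff_mat_carrier)
  show ?thesis
  proof (rule eq_matI)
    fix i j assume "i < dim_row (diff_mat (H @\<^sub>r H') (K @\<^sub>r K'))" "j < dim_col (diff_mat (H @\<^sub>r H') (K @\<^sub>r K'))"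
    then have i: "i < p + p'" and j: "j < n + n'" by (simp_all add: ix)
    show "(diff_mat H K @\<^sub>r diff_mat H' K') $$ (i, j) = diff_mat (H @\<^sub>r H') (K @\<^sub>r K') $$ (i, j)"
      using i j assms c'
      by (simp add: ix rows[of _ "n + n'"] rows[of _ n] rows[of _ n'])
  qed (use carrier_matD[OF carrier_append_rows[OF c']] in \<open>simp_all add: ix\<close>)
qed

section \<open>Outputs of the augmented system\<close>

context observation
begin

lemma diff_observation: "observation (n + n) r (diff_mat C C) V"
  by unfold_locales (use C V in \<open>auto intro: diff_mat_carrier\<close>)

lemma out_map_diff:
  assumes "\<And>k. k < N \<Longrightarrow> A k \<in> carrier_mat n n" "\<And>k. k < N \<Longrightarrow> A' k \<in> carrier_mat n n"
  shows "out_map (diff_mat C C) (\<lambda>k. block_diag (A k) (A' k)) N = diff_mat (out_map C A N) (out_map C A' N)"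
  using assms
proof (induction N arbitrary: A A')
  case (Suc N)
  let ?H = "out_map C (\<lambda>k. A (Suc k)) N" and ?H' = "out_map C (\<lambda>k. A' (Suc k)) N"
  have A0: "A 0 \<in> carrier_mat n n" "A' 0 \<in> carrier_mat n n" using Suc.prems[of 0] by auto
  have H: "?H \<in> carrier_mat (Suc N * r) n" "?H' \<in> carrier_mat (Suc N * r) n"
    using Suc.prems by (auto intro!: out_map_carrier simp del: mult_Suc)
  have HA: "?H * A 0 \<in> carrier_mat (Suc N * r) n" "?H' * A' 0 \<in> carrier_mat (Suc N * r) n"
    using H A0 by (auto simp del: mult_Suc)
  have "out_map (diff_mat C C) (\<lambda>k. block_diag (A (Suc k)) (A' (Suc k))) N = diff_mat ?H ?H'"
    using Suc.prems by (intro Suc.IH) auto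
  then show ?case
    by (simp add: diff_mat_mult_block_diag[OF H A0] diff_mat_append_rows[OF C C HA])
qed simp

text \<open>Each innovation covariance on the right contains \<open>V\<close>, and half of the two
  copies is \<open>V\<close> again. With the scale 1/sqrt 2 the augmented system thus has the same
  observation noise as the original one.\<close>

lemma innov_cov_diff:
  assumes "P \<in> carrier_mat n n" "P' \<in> carrier_mat n n"
  shows "innov_cov (diff_mat C C) V (block_diag P P')
    = (1 / 2) \<cdot>\<^sub>m (innov_cov C V P + innov_cov C V P')"
proof -
  have "C * P \<in> carrier_mat r n" "C * P' \<in> carrier_mat r n" using assms C by auto
  then show ?thesis
    unfolding innov_cov_def diff_mat_mult_block_diag[OF C C assms]
    using C dims by (subst diff_mat_mult_transpose) (auto intro!: eq_matI)
qed

lemma out_mean_diff: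
  assumes "\<And>k. k < N \<Longrightarrow> A k \<in> carrier_mat n n" "\<And>k. k < N \<Longrightarrow> A' k \<in> carrier_mat n n"
    and "\<And>k. k < N \<Longrightarrow> B k \<in> carrier_vec n" "\<And>k. k < N \<Longrightarrow> B' k \<in> carrier_vec n"
    and "m \<in> carrier_vec n" "m' \<in> carrier_vec n"
  shows "out_mean (diff_mat C C) (\<lambda>k. block_diag (A k) (A' k)) (\<lambda>k. B k @\<^sub>v B' k) (m @\<^sub>v m') N
    = (1 / sqrt 2) \<cdot>\<^sub>v (out_mean C A B m N - out_mean C A' B' m' N)"
  using assms
proof (induction N arbitrary: A A' B B' m m')
  case 0
  then show ?case by (simp add: diff_mat_mult_vec[OF C C])
next
  case (Suc N)
  have A0: "A 0 \<in> carrier_mat n n" "A' 0 \<in> carrier_mat n n"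
    and B0: "B 0 \<in> carrier_vec n" "B' 0 \<in> carrier_vec n" using Suc.prems(1-4)[of 0] by auto
  have m1: "A 0 *\<^sub>v m + B 0 \<in> carrier_vec n" "A' 0 *\<^sub>v m' + B' 0 \<in> carrier_vec n"
    using B0 by (auto intro!: carrier_vecI)
  let ?x = "out_mean C (\<lambda>k. A (Suc k)) (\<lambda>k. B (Suc k)) (A 0 *\<^sub>v m + B 0) N"
  let ?y = "out_mean C (\<lambda>k. A' (Suc k)) (\<lambda>k. B' (Suc k)) (A' 0 *\<^sub>v m' + B' 0) N"
  have xy: "?x \<in> carrier_vec (Suc N * r)" "?y \<in> carrier_vec (Suc N * r)" by (rule out_mean_carrier)+
  have "block_diag (A 0) (A' 0) *\<^sub>v (m @\<^sub>v m') + (B 0 @\<^sub>v B' 0)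
    = (A 0 *\<^sub>v m + B 0) @\<^sub>v (A' 0 *\<^sub>v m' + B' 0)"
    using A0 B0 Suc.prems(5,6)
    by (simp add: block_diag_mult_vec) (intro eq_vecI, auto)
  then have "out_mean (diff_mat C C) (\<lambda>k. block_diag (A (Suc k)) (A' (Suc k))) (\<lambda>k. B (Suc k) @\<^sub>v B' (Suc k))
      (block_diag (A 0) (A' 0) *\<^sub>v (m @\<^sub>v m') + (B 0 @\<^sub>v B' 0)) N = (1 / sqrt 2) \<cdot>\<^sub>v (?x - ?y)"
    using Suc.prems m1 by (simp only:, intro Suc.IH) auto
  moreover have "((1 / sqrt 2) \<cdot>\<^sub>v (C *\<^sub>v m - C *\<^sub>v m')) @\<^sub>v ((1 / sqrt 2) \<cdot>\<^sub>v (?x - ?y))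
    = (1 / sqrt 2) \<cdot>\<^sub>v (((C *\<^sub>v m) @\<^sub>v ?x) - ((C *\<^sub>v m') @\<^sub>v ?y))"
    using dims carrier_vecD[OF xy(1)] carrier_vecD[OF xy(2)] by (intro eq_vecI) auto
  ultimately show ?case using Suc.prems by (simp add: diff_mat_mult_vec[OF C C])
qed

text \<open>\<open>out_cov\<close> propagates unconditional covariances, so block-diagonal dynamics
  keep the state covariance block-diagonal and every output block is an average. The analogous claim
  for \<open>pred_cov\<close> fails in general, since an update couples the halves.\<close>

lemma out_cov_diff:
  assumes "\<And>k. k < N \<Longrightarrow> A k \<in> carrier_mat n n" "\<And>k. k < N \<Longrightarrow> A' k \<in> carrier_mat n n"
    and "\<And>k. k < N \<Longrightarrow> G k \<in> carrier_mat n q" "\<And>k. k < N \<Longrightarrow> G' k \<in> carrier_mat n q"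
    and "P \<in> carrier_mat n n" "P' \<in> carrier_mat n n"
  shows "out_cov (diff_mat C C) V (\<lambda>k. block_diag (A k) (A' k)) (\<lambda>k. block_diag (G k) (G' k)) (block_diag P P') N
    = (1 / 2) \<cdot>\<^sub>m (out_cov C V A G P N + out_cov C V A' G' P' N)"
  using assms
proof (induction N arbitrary: A A' G G' P P')
  case 0
  then show ?case by (simp add: innov_cov_diff)
next
  case (Suc N)
  let ?m = "Suc N * r"
  have A0: "A 0 \<in> carrier_mat n n" "A' 0 \<in> carrier_mat n n"
    and G0: "G 0 \<in> carrier_mat n q" "G' 0 \<in> carrier_mat n q" using Suc.prems(1-4)[of 0] by auto
  note P = Suc.prems(5,6)
  define R where "R = A 0 * P * transpose_mat (A 0) + G 0 * transpose_mat (G 0)"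
  define R' where "R' = A' 0 * P' * transpose_mat (A' 0) + G' 0 * transpose_mat (G' 0)"
  define H where "H = out_map C (\<lambda>k. A (Suc k)) N * A 0"
  define H' where "H' = out_map C (\<lambda>k. A' (Suc k)) N * A' 0"
  have R: "R \<in> carrier_mat n n" "R' \<in> carrier_mat n n" using A0 G0 P by (auto simp: R_def R'_def intro!: carrier_matI)
  have O: "out_map C (\<lambda>k. A (Suc k)) N \<in> carrier_mat ?m n" "out_map C (\<lambda>k. A' (Suc k)) N \<in> carrier_mat ?m n"
    using Suc.prems by (auto intro!: out_map_carrier simp del: mult_Suc)
  have H: "H \<in> carrier_mat ?m n" "H' \<in> carrier_mat ?m n"
    using O A0 by (auto simp: H_def H'_def simp del: mult_Suc)
  let ?S = "out_cov C V (\<lambda>k. A (Suc k)) (\<lambda>k. G (Suc k)) R N"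
    and ?S' = "out_cov C V (\<lambda>k. A' (Suc k)) (\<lambda>k. G' (Suc k)) R' N"
  have I: "innov_cov C V P \<in> carrier_mat r r" "innov_cov C V P' \<in> carrier_mat r r"
    using dims by (auto simp: innov_cov_def intro!: carrier_matI)
  have S: "?S \<in> carrier_mat ?m ?m" "?S' \<in> carrier_mat ?m ?m" by (rule out_cov_carrier)+
  have "out_map (diff_mat C C) (\<lambda>k. block_diag (A (Suc k)) (A' (Suc k))) N * block_diag (A 0) (A' 0)
    = diff_mat H H'"
    unfolding H_def H'_def using Suc.prems
    by (subst out_map_diff) (auto simp: diff_mat_mult_block_diag[OF O A0])
  moreover have "block_diag (A 0) (A' 0) * block_diag P P' * transpose_mat (block_diag (A 0) (A' 0))
      + block_diag (G 0) (G' 0) * transpose_mat (block_diag (G 0) (G' 0)) = block_diag R R'"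
  proof -
    have 1: "A 0 * P \<in> carrier_mat n n" "A' 0 * P' \<in> carrier_mat n n" using A0 P by auto
    have 2: "transpose_mat (A 0) \<in> carrier_mat n n" "transpose_mat (A' 0) \<in> carrier_mat n n"
      "transpose_mat (G 0) \<in> carrier_mat q n" "transpose_mat (G' 0) \<in> carrier_mat q n" using A0 G0 by auto
    have 3: "A 0 * P * transpose_mat (A 0) \<in> carrier_mat n n" "A' 0 * P' * transpose_mat (A' 0) \<in> carrier_mat n n"
      "G 0 * transpose_mat (G 0) \<in> carrier_mat n n" "G' 0 * transpose_mat (G' 0) \<in> carrier_mat n n"
      using 1 2 G0 by auto
    show ?thesis
      unfolding R_def R'_def transpose_block_diag[OF A0] transpose_block_diag[OF G0]
        block_diag_mult[OF A0 P] block_diag_mult[OF 1 2(1,2)] block_diag_mult[OF G0 2(3,4)]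
        block_diag_add[OF 3] ..
  qed
  moreover have "out_cov (diff_mat C C) V (\<lambda>k. block_diag (A (Suc k)) (A' (Suc k)))
      (\<lambda>k. block_diag (G (Suc k)) (G' (Suc k))) (block_diag R R') N
    = (1 / 2) \<cdot>\<^sub>m (?S + ?S')"
    using Suc.prems R by (intro Suc.IH) auto
  moreover have CP: "C * P \<in> carrier_mat r n" "C * P' \<in> carrier_mat r n" using C P by auto
  moreover have HP: "H * P \<in> carrier_mat ?m n" "H' * P' \<in> carrier_mat ?m n"
    using H P by (auto simp del: mult_Suc)
  ultimately have "out_cov (diff_mat C C) V (\<lambda>k. block_diag (A k) (A' k)) (\<lambda>k. block_diag (G k) (G' k))
      (block_diag P P') (Suc N)
    = four_block_mat ((1 / 2) \<cdot>\<^sub>m (innov_cov C V P + innov_cov C V P'))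
        ((1 / 2) \<cdot>\<^sub>m (C * P * transpose_mat H + C * P' * transpose_mat H'))
        ((1 / 2) \<cdot>\<^sub>m (H * P * transpose_mat C + H' * P' * transpose_mat C))
        ((1 / 2) \<cdot>\<^sub>m (?S + ?S'))"
    by (simp add: Let_def innov_cov_diff[OF P] diff_mat_mult_block_diag[OF C C P]
        diff_mat_mult_block_diag[OF H P] diff_mat_mult_transpose[OF CP H]
        diff_mat_mult_transpose[OF HP C C])
  also have "\<dots> = (1 / 2) \<cdot>\<^sub>m (four_block_mat (innov_cov C V P) (C * P * transpose_mat H) (H * P * transpose_mat C) ?S
      + four_block_mat (innov_cov C V P') (C * P' * transpose_mat H') (H' * P' * transpose_mat C) ?S')"
    using C H P I S
    by (subst add_four_block_mat[of _ r r _ ?m _ ?m], simp_all del: mult_Suc,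
        subst smult_four_block_mat[of _ r r _ ?m _ ?m])
       (auto intro!: carrier_matI simp del: mult_Suc)
  finally show ?case
    by (simp only: out_cov.simps Let_def H_def[symmetric] H'_def[symmetric] R_def[symmetric] R'_def[symmetric])
qed

end

section \<open>Assembly for a pair of parameters\<close>

text \<open>Real \<open>ln\<close> is additive on all nonzero arguments, where it is ln |x|, so
  nonvanishing determinants suffice to split the logarithm.\<close>

lemma ln_prod_nonzero:
  fixes f :: "nat \<Rightarrow> real"
  shows "(\<And>k. k \<le> N \<Longrightarrow> f k \<noteq> 0) \<Longrightarrow> ln (\<Prod>k\<le>N. f k) = (\<Sum>k\<le>N. ln (f k))"
proof (induction N)
  case (Suc N)
  have "(\<Prod>k\<le>N. f k) \<noteq> 0" using Suc.prems by simp
  then show ?case using Suc by (simp add: ln_mult)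
qed simp

lemma stacked_eq:
  "stackedC \<S> = kronecker (1\<^sub>m (Suc (horizon \<S>))) (Cmat \<S>)"
  "stackedA \<S> \<theta> u = stack_A (dim_x \<S>) (\<lambda>k. Amat \<S> \<theta> (u k)) (horizon \<S>)"
  "stackedB \<S> \<theta> u = stack_B (dim_x \<S>) (\<lambda>k. Amat \<S> \<theta> (u k)) (\<lambda>k. Bvec \<S> \<theta> (u k)) (horizon \<S>)"
  "stackedG \<S> \<theta> u = stack_G (dim_x \<S>) (dim_w \<S>) (\<lambda>k. Amat \<S> \<theta> (u k)) (\<lambda>k. Gmat \<S> \<theta> (u k)) (horizon \<S>)"
  by (simp_all add: stackedC_def stackedA_def stackedB_def stackedG_def stack_A_def stack_B_def
      stack_G_def transition_eq_state_trans cong: if_cong)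

lemma tildem_eq_pred_mean:
  assumes "Cmat \<S> \<in> carrier_mat (dim_y \<S>) (dim_x \<S>)"
  shows "tildem \<S> \<theta>i \<theta>j u k
    = pred_mean (tildeA \<S> \<theta>i \<theta>j u) (tildeB \<S> \<theta>i \<theta>j u) (tildeG \<S> \<theta>i \<theta>j u) (tildeC \<S>) (Sv \<S>)
        (block_diag (S0 \<S> \<theta>i) (S0 \<S> \<theta>j)) (m0 \<S> \<theta>i @\<^sub>v m0 \<S> \<theta>j) k"
proof (induction k)
  case (Suc k)
  \<comment> \<open>Matches the identity of size \<open>2 * dim_x \<S>\<close> in
    \<open>tildem\<close> with the one of size \<open>dim_col C\<close> in
    \<open>pred_mean\<close>.\<close>
  have "dim_col (tildeC \<S>) = 2 * dim_x \<S>"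
    using assms by (simp add: tildeC_def append_cols_def)
  with Suc show ?case by (simp add: tildeL_def tildeS_pred_def)
qed simp

theorem lemma4:
  fixes \<S> :: quasi_linear_system
    and \<theta>i \<theta>j :: "real vec"
    and u :: "nat \<Rightarrow> real vec"
  assumes "wf_system \<S>"
    and "\<theta>i \<in> Theta \<S>" and "\<theta>j \<in> Theta \<S>"
    and "\<And>k. k < horizon \<S> \<Longrightarrow> u k \<in> carrier_vec (dim_u \<S>)"
  shows "dist_d \<S> \<theta>i \<theta>j u =
           1/4 * (\<Sum>k = 0..horizon \<S>.
                    wnorm2 (minv (tildeSigma \<S> \<theta>i \<theta>j u k)) (tildeC \<S> *\<^sub>v tildem \<S> \<theta>i \<theta>j u k))
         + 1/2 * (\<Sum>k = 0..horizon \<S>. ln (det (tildeSigma \<S> \<theta>i \<theta>j u k)))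
         - 1/4 * ln (det (covS \<S> \<theta>i u) * det (covS \<S> \<theta>j u))
       \<and> det (covS \<S> \<theta>i u) = (\<Prod>k = 0..horizon \<S>. det (Sigma_k \<S> \<theta>i u k))
       \<and> det (covS \<S> \<theta>j u) = (\<Prod>k = 0..horizon \<S>. det (Sigma_k \<S> \<theta>j u k))"
proof -
  define n r q N C V where "n = dim_x \<S>" and "r = dim_y \<S>" and "q = dim_w \<S>" and "N = horizon \<S>"
    and "C = Cmat \<S>" and "V = Sv \<S>"
  note nd = n_def r_def q_def N_def C_def V_def
  define A where "A \<theta> = (\<lambda>k. Amat \<S> \<theta> (u k))" for \<theta>
  define B where "B \<theta> = (\<lambda>k. Bvec \<S> \<theta> (u k))" for \<theta>
  define G where "G \<theta> = (\<lambda>k. Gmat \<S> \<theta> (u k))" for \<theta>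
  have C: "C \<in> carrier_mat r n" and V: "pos_def r V" using assms(1) by (auto simp: wf_system_def nd)
  have ABG: "A \<theta> k \<in> carrier_mat n n" "B \<theta> k \<in> carrier_vec n" "G \<theta> k \<in> carrier_mat n q"
    if "\<theta> \<in> Theta \<S>" "k < N" for \<theta> k
    using assms(1,4) that by (auto simp: wf_system_def A_def B_def G_def nd)
  have m0: "m0 \<S> \<theta> \<in> carrier_vec n" and S0: "pos_semidef n (S0 \<S> \<theta>)" if "\<theta> \<in> Theta \<S>" for \<theta>
    using assms(1) that pos_def_imp_pos_semidef by (auto simp: wf_system_def nd)
  interpret obs: observation n r C V by unfold_locales (fact C V)+
  \<comment> \<open>The filter results proved once for a general system now hold for the augmented
    one, with state dimension n + n.\<close>
  interpret diff: observation "n + n" r "diff_mat C C" V by (rule obs.diff_observation)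

  have mean: "meanF \<S> \<theta> u = out_mean C (A \<theta>) (B \<theta>) (m0 \<S> \<theta>) N" if "\<theta> \<in> Theta \<S>" for \<theta>
    using obs.out_mean_eq_stack[of N "A \<theta>" "B \<theta>" "m0 \<S> \<theta>"] ABG m0 that
    by (simp add: meanF_def stacked_eq A_def B_def nd)
  have cov: "covS \<S> \<theta> u = out_cov C V (A \<theta>) (G \<theta>) (S0 \<S> \<theta>) N" if "\<theta> \<in> Theta \<S>" for \<theta>
    using obs.out_cov_eq_stack[of N "A \<theta>" "G \<theta>" q "S0 \<S> \<theta>"] ABG pos_semidefD(1)[OF S0] that
    by (simp add: covS_def stacked_eq A_def G_def nd)
  have det: "det (covS \<S> \<theta> u) = (\<Prod>k = 0..horizon \<S>. det (Sigma_k \<S> \<theta> u k))" if "\<theta> \<in> Theta \<S>" for \<theta>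
    using obs.det_out_cov[of N "A \<theta>" "G \<theta>" q "S0 \<S> \<theta>"] ABG S0 that
    by (simp add: cov Sigma_k_def A_def G_def nd atLeast0AtMost)

  let ?A = "\<lambda>k. block_diag (A \<theta>i k) (A \<theta>j k)" and ?B = "\<lambda>k. B \<theta>i k @\<^sub>v B \<theta>j k"
    and ?G = "\<lambda>k. block_diag (G \<theta>i k) (G \<theta>j k)" and ?P = "block_diag (S0 \<S> \<theta>i) (S0 \<S> \<theta>j)"
    and ?m = "m0 \<S> \<theta>i @\<^sub>v m0 \<S> \<theta>j"
  have A: "?A k \<in> carrier_mat (n + n) (n + n)" and B: "?B k \<in> carrier_vec (n + n)"
    and G: "?G k \<in> carrier_mat (n + n) (q + q)" if "k < N" for k
    using ABG assms(2,3) that by (auto intro: block_diag_carrier)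
  have P: "pos_semidef (n + n) ?P" and m: "?m \<in> carrier_vec (n + n)"
    using S0 m0 assms(2,3) by (auto intro: pos_semidef_block_diag)
  define \<Sigma> where "\<Sigma> k = innov_cov (diff_mat C C) V (pred_cov ?A ?G (diff_mat C C) V ?P k)" for k
  define \<mu> where "\<mu> k = pred_mean ?A ?B ?G (diff_mat C C) V ?P ?m k" for k
  have tilde: "tildeC \<S> = diff_mat C C" "tildeA \<S> \<theta>i \<theta>j u = ?A" "tildeB \<S> \<theta>i \<theta>j u = ?B"
    "tildeG \<S> \<theta>i \<theta>j u = ?G"
    by (simp_all add: fun_eq_iff tildeC_def diff_mat_def tildeA_def tildeB_def tildeG_def A_def B_def G_def nd)
  have Sigma: "tildeSigma \<S> \<theta>i \<theta>j u k = \<Sigma> k" for k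
    by (simp add: tildeSigma_def tildeS_pred_def \<Sigma>_def tilde V_def)
  have mu: "tildem \<S> \<theta>i \<theta>j u k = \<mu> k" for k
    using C by (subst tildem_eq_pred_mean) (auto simp: \<mu>_def tilde nd)

  define \<Delta> where "\<Delta> = meanF \<S> \<theta>i u - meanF \<S> \<theta>j u"
  define M where "M = (1/2) \<cdot>\<^sub>m (covS \<S> \<theta>i u + covS \<S> \<theta>j u)"
  have M: "M = out_cov (diff_mat C C) V ?A ?G ?P N"
    unfolding M_def using assms(2,3) ABG pos_semidefD(1)[OF S0]
    by (simp add: cov obs.out_cov_diff[where q = q])
  have M_carrier: "M \<in> carrier_mat (Suc N * r) (Suc N * r)" unfolding M by (rule diff.out_cov_carrier)
  have \<Delta>: "(1 / sqrt 2) \<cdot>\<^sub>v \<Delta> = out_mean (diff_mat C C) ?A ?B ?m N"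
    unfolding \<Delta>_def using assms(2,3) ABG m0 by (simp add: mean obs.out_mean_diff)
  have \<Delta>_carrier: "\<Delta> \<in> carrier_vec (Suc N * r)"
    using obs.out_mean_carrier assms(2,3) unfolding \<Delta>_def by (simp only: mean minus_carrier_vec)
  have Sigma_nz: "det (\<Sigma> k) \<noteq> 0" if "k \<le> N" for k
    unfolding \<Sigma>_def using A G P that by (intro diff.det_innov_cov_nonzero)
  have det_M: "det M = (\<Prod>k\<le>N. det (\<Sigma> k))"
    unfolding M \<Sigma>_def using A G P by (intro diff.det_out_cov)
  \<comment> \<open>Invertibility of the averaged covariance is read off its determinant formula,
    and only then is its inverse used.\<close>
  then have M_nz: "det M \<noteq> 0" using Sigma_nz by simp
  note M_inv = minv_inverse[OF M_carrier M_nz]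
  \<comment> \<open>The solution of M s = \<Delta>/sqrt 2 that \<open>out_cov_quadratic_form\<close>
    asks for.\<close>
  define s where "s = minv M *\<^sub>v ((1 / sqrt 2) \<cdot>\<^sub>v \<Delta>)"
  have s: "s \<in> carrier_vec (Suc N * r)"
    unfolding s_def using M_inv(1) \<Delta>_carrier by (intro mult_mat_vec_carrier) auto
  have "M *\<^sub>v s = (M * minv M) *\<^sub>v ((1 / sqrt 2) \<cdot>\<^sub>v \<Delta>)"
    unfolding s_def using M_carrier M_inv(1) \<Delta>_carrier by (intro assoc_mult_mat_vec[symmetric]) auto
  then have "M *\<^sub>v s = (1 / sqrt 2) \<cdot>\<^sub>v \<Delta>"
    unfolding M_inv(2) using \<Delta>_carrier by (simp del: mult_Suc)
  then have "((1 / sqrt 2) \<cdot>\<^sub>v \<Delta>) \<bullet> s = (\<Sum>k\<le>N. wnorm2 (minv (\<Sigma> k)) (diff_mat C C *\<^sub>v \<mu> k))"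
    unfolding \<Sigma>_def \<mu>_def M \<Delta> using A B G P m s by (intro diff.out_cov_quadratic_form)
  \<comment> \<open>One factor 1/sqrt 2 comes from the mean and one from \<open>s\<close>; together
    they give the 1/2 that links the coefficients 1/8 and 1/4.\<close>
  moreover have "((1 / sqrt 2) \<cdot>\<^sub>v \<Delta>) \<bullet> s = (1 / 2) * wnorm2 (minv M) \<Delta>"
  proof -
    have "s = (1 / sqrt 2) \<cdot>\<^sub>v (minv M *\<^sub>v \<Delta>)"
      unfolding s_def using M_inv(1) \<Delta>_carrier by (intro mult_mat_vec)
    then show ?thesis
      using M_inv(1) \<Delta>_carrier by (simp add: wnorm2_def field_simps del: mult_Suc)
  qed
  moreover have "ln (det M) = (\<Sum>k\<le>N. ln (det (\<Sigma> k)))"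
    unfolding det_M by (rule ln_prod_nonzero) (rule Sigma_nz)
  ultimately have "dist_d \<S> \<theta>i \<theta>j u =
      1/4 * (\<Sum>k\<le>N. wnorm2 (minv (\<Sigma> k)) (diff_mat C C *\<^sub>v \<mu> k))
      + 1/2 * (\<Sum>k\<le>N. ln (det (\<Sigma> k))) - 1/4 * ln (det (covS \<S> \<theta>i u) * det (covS \<S> \<theta>j u))"
    unfolding dist_d_def Let_def \<Delta>_def[symmetric] M_def[symmetric] by simp
  then show ?thesis
    using det[OF assms(2)] det[OF assms(3)] by (simp add: Sigma mu tilde N_def atLeast0AtMost)
qed

end
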